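(* For every $\xi\in\mathbb{R}\setminus\mathbb{Q}$ and every $d\in[0,1)$, there is an $F_\sigma$ set $A\subseteq\mathbb{R}$ that is a $\mathbb{Q}$-vector subspace of $\mathbb{R}$ and satisfies $$\dim_{\mathrm H} A=d\qquad\text{and}\qquad A+\xi A=\mathbb{R}.$$
   Context: $\dim_{\mathrm H}$ denotes Hausdorff dimension with respect to the Euclidean metric. For $A\subseteq\mathbb{R}$ and $\xi\in\mathbb{R}$, $A+\xi A=\{a+\xi b: a,b\in A\}$. $F_\sigma$ means a countable union of closed subsets of $\mathbb{R}$. *)

theory Defs
  imports "HOL-Analysis.Analysis"
begin

(* (diam U)^s with the usual conventions of geometric measure theory: the empty set
   contributes 0, and for s = 0 every nonempty set contributes 1 (so the 0-dimensional
   measure is the counting measure); powr alone would give 0 powr 0 = 0 for singletons. *)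
definition diam_pow :: "real \<Rightarrow> 'a::metric_space set \<Rightarrow> ennreal" where
  "diam_pow s U =
     (if U = {} then 0 else if s = 0 then 1 else ennreal (diameter U powr s))"

(* Boundedness is required explicitly because diameter is a real number and carries no
   information on unbounded sets.  Finite covers are included: U i may be empty. *)
definition hausdorff_content :: "real \<Rightarrow> real \<Rightarrow> 'a::metric_space set \<Rightarrow> ennreal" where
  "hausdorff_content s \<delta> A =
     (INF U \<in> {U :: nat \<Rightarrow> 'a set. A \<subseteq> (\<Union>i. U i) \<and> (\<forall>i. bounded (U i) \<and> diameter (U i) \<le> \<delta>)}.
        (\<Sum>i. diam_pow s (U i)))"

definition hausdorff_measure :: "real \<Rightarrow> 'a::metric_space set \<Rightarrow> ennreal" where
  "hausdorff_measure s A = (SUP \<delta> \<in> {0<..}. hausdorff_content s \<delta> A)"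

(* The infimum of the empty set is infinity, hence the extended real value. *)
definition hausdorff_dim :: "'a::metric_space set \<Rightarrow> ereal" where
  "hausdorff_dim A = Inf (ereal ` {s. 0 \<le> s \<and> hausdorff_measure s A = 0})"

abbreviation rat_scale :: "rat \<Rightarrow> real \<Rightarrow> real" where
  "rat_scale q x \<equiv> of_rat q * x"

lemma vector_space_rat_scale: "vector_space rat_scale"
  by unfold_locales (simp_all add: algebra_simps of_rat_add of_rat_mult)

end

theory Submission
  imports Defs "HOL-Real_Asymp.Real_Asymp"
begin

text \<open>
  The tension in the theorem is that a small set \<open>A\<close> has a surjective image \<open>A \<times> A \<rightarrow> \<real>\<close>,
  \<open>(x, y) \<mapsto> x + \<xi> y\<close>. By Baire's theorem, some bounded part of \<open>A\<close> needs at least about \<open>r^(-1/2)\<close>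
  intervals of any given common length \<open>r\<close>; for \<open>d < 1/2\<close>, different points of this part must
  therefore be covered at different scales.

  Let \<open>\<omega>\<close> range over binary digit sequences and cut the digit positions into the blocks
  \<open>n! \<le> i < (n+1)!\<close>. Consider
    \<open>X \<omega> = \<Sum>i. \<omega>\<^sub>i \<alpha>\<^sub>n(\<omega>) / 2^(i+1)\<close> and \<open>Y \<omega> = \<Sum>i. \<omega>\<^sub>i \<beta>\<^sub>n(\<omega>) / 2^(i+1)\<close>,
  where \<open>n\<close> is the block of \<open>i\<close> and \<open>\<alpha>\<^sub>n + \<xi> \<beta>\<^sub>n = 1\<close>. Then \<open>X + \<xi> Y\<close> is the number with binary digits
  \<open>\<omega>\<close>, so every \<open>\<rat>\<close>-subspace that contains all the values of \<open>X\<close> and \<open>Y\<close> satisfies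
  \<open>A + \<xi> A = \<real>\<close>. Since \<open>\<xi>\<close> is irrational, for each rational \<open>(s, t) \<noteq> 0\<close> there is a choice
  \<open>\<alpha> = t / (t - \<xi> s)\<close>, \<open>\<beta> = - s / (t - \<xi> s)\<close> that makes \<open>s \<alpha> + t \<beta> = 0\<close>: with this choice in block \<open>n\<close>, the
  digits of that block do not contribute to \<open>s X + t Y\<close>.

  The choice in block \<open>n\<close> may depend on the digits of \<open>\<omega>\<close> before position \<open>n\<close>. Hence distinct digit
  sequences can be given different directions in one block, and there are only countably many
  finite tables that assign rational directions to the prefixes of a given length. Running through
  all tables infinitely often (\<open>directions_exist\<close>), one arranges that every finite rational
  combination of values \<open>X \<omega>\<close>, \<open>Y \<omega>\<close> loses infinitely many entire blocks. As \<open>(n+1)!\<close> is much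
  larger than \<open>n!\<close>, the few digits before a lost block leave so few possibilities that such
  combinations form a set of dimension 0.

  To reach dimension \<open>d\<close>, a third series \<open>W \<omega> = \<Sum>j. \<omega>\<^sub>j / 2^(a\<^sub>j + 1)\<close> is added, whose positions \<open>a\<^sub>j\<close>
  fill about the proportion \<open>d\<close> of each interval \<open>[0, (n+1)!)\<close> and then leave a gap
  (\<open>gapped_positions_exist\<close>). At the scale of the end of block \<open>n\<close>, every rational combination of values
  of \<open>W\<close> lies near a grid with \<open>2^(d (n+1)! + o((n+1)!))\<close> points in a bounded interval, which gives
  dimension at most \<open>d\<close> for all combinations of \<open>X\<close>, \<open>Y\<close>, \<open>W\<close> (\<open>comb_cover\<close>,
  \<open>null_if_block_covers\<close>). Conversely, for \<open>d > 0\<close>, reading the digits of \<open>W \<omega>\<close> without the gaps is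
  Hoelder continuous of exponent \<open>d\<close> and maps onto \<open>[0, 1)\<close> (\<open>binary_Holder\<close>), so the dimension is at least
  \<open>d\<close> (\<open>hausdorff_measure_pos_if_Holder_onto\<close>).

  The span \<open>A\<close> is the union, over the countably many tables of rational coefficients on the prefixes
  of some length, of the sets of combinations with those coefficients and with one digit sequence
  in each cylinder. Each of these sets is a continuous image of a compact space, so \<open>A\<close> is
  \<open>F\<^sub>\<sigma>\<close>.
\<close>

section \<open>Null sets and positivity for Hausdorff measures\<close>

lemma hausdorff_content_eq_0_iff:
  "hausdorff_content s \<delta> A = 0 \<longleftrightarrow>
     (\<forall>\<epsilon>>0. \<exists>U :: nat \<Rightarrow> 'a::metric_space set. A \<subseteq> (\<Union>i. U i)
        \<and> (\<forall>i. bounded (U i) \<and> diameter (U i) \<le> \<delta>) \<and> (\<Sum>i. diam_pow s (U i)) \<le> ennreal \<epsilon>)"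
  (is "_ \<longleftrightarrow> ?R")
proof
  assume 0: "hausdorff_content s \<delta> A = 0"
  show ?R
  proof (intro allI impI)
    fix \<epsilon> :: real assume "\<epsilon> > 0"
    then have "hausdorff_content s \<delta> A < ennreal \<epsilon>" using 0 by simp
    then show "\<exists>U :: nat \<Rightarrow> 'a set. A \<subseteq> (\<Union>i. U i)
        \<and> (\<forall>i. bounded (U i) \<and> diameter (U i) \<le> \<delta>) \<and> (\<Sum>i. diam_pow s (U i)) \<le> ennreal \<epsilon>"
      unfolding hausdorff_content_def INF_less_iff by (auto dest: less_imp_le)
  qed
next
  assume R: ?R
  have "hausdorff_content s \<delta> A \<le> 0"
  proof (rule ennreal_le_epsilon)
    fix e :: real assume "e > 0"
    then obtain U :: "nat \<Rightarrow> 'a set" where U: "A \<subseteq> (\<Union>i. U i)"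
        "\<forall>i. bounded (U i) \<and> diameter (U i) \<le> \<delta>" "(\<Sum>i. diam_pow s (U i)) \<le> ennreal e"
      using R by blast
    show "hausdorff_content s \<delta> A \<le> 0 + ennreal e"
      unfolding hausdorff_content_def using U by (auto intro!: INF_lower2[of U])
  qed
  then show "hausdorff_content s \<delta> A = 0" by simp
qed

lemma hausdorff_measure_eq_0_iff:
  "hausdorff_measure s A = 0 \<longleftrightarrow> (\<forall>\<delta>>0. hausdorff_content s \<delta> A = 0)"
  unfolding hausdorff_measure_def by (auto simp: SUP_eq_iff bot_ennreal[symmetric])

lemma hausdorff_measure_mono:
  assumes "A \<subseteq> B" shows "hausdorff_measure s A \<le> hausdorff_measure s B"
  unfolding hausdorff_measure_def hausdorff_content_def using assms
  by (intro SUP_mono' INF_superset_mono) auto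

text \<open>The cover of the \<open>n\<close>-th set gets the share \<open>\<epsilon> / 2 ^ Suc n\<close>; the covers are merged by a pairing
  of the indices.\<close>
lemma hausdorff_measure_null_UN:
  fixes S :: "nat \<Rightarrow> 'a::metric_space set"
  assumes "\<And>n. hausdorff_measure s (S n) = 0"
  shows "hausdorff_measure s (\<Union>n. S n) = 0"
  unfolding hausdorff_measure_eq_0_iff hausdorff_content_eq_0_iff
proof (intro allI impI)
  fix \<delta> \<epsilon> :: real assume pos: "\<delta> > 0" "\<epsilon> > 0"
  have "\<exists>U :: nat \<Rightarrow> 'a set. S n \<subseteq> (\<Union>i. U i) \<and> (\<forall>i. bounded (U i) \<and> diameter (U i) \<le> \<delta>)
      \<and> (\<Sum>i. diam_pow s (U i)) \<le> ennreal (\<epsilon> / 2 ^ Suc n)" for n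
    using assms[of n] pos unfolding hausdorff_measure_eq_0_iff hausdorff_content_eq_0_iff
    by (metis divide_pos_pos zero_less_numeral zero_less_power)
  then obtain U :: "nat \<Rightarrow> nat \<Rightarrow> 'a set" where U: "\<And>n. S n \<subseteq> (\<Union>i. U n i)"
    "\<And>n i. bounded (U n i) \<and> diameter (U n i) \<le> \<delta>"
    "\<And>n. (\<Sum>i. diam_pow s (U n i)) \<le> ennreal (\<epsilon> / 2 ^ Suc n)"
    by metis
  define V where "V k = (case prod_decode k of (n, i) \<Rightarrow> U n i)" for k
  have V: "V (prod_encode (n, i)) = U n i" for n i by (simp add: V_def)
  have cover: "(\<Union>n. S n) \<subseteq> (\<Union>k. V k)"
    using U(1) V by (smt (verit, ccfv_threshold) UN_E UN_I UNIV_I subset_iff)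
  have "(\<Sum>k. diam_pow s (V k)) = (\<Sum>k. (\<lambda>(n, i). diam_pow s (U n i)) (prod_decode k))"
    by (simp add: V_def split_beta)
  also have "\<dots> = (\<Sum>n. \<Sum>i. diam_pow s (U n i))"
    by (rule suminf_ennreal_2dimen) simp
  also have "\<dots> \<le> (\<Sum>n. ennreal (\<epsilon> / 2 ^ Suc n))"
    by (intro suminf_le U(3)) auto
  also have "\<dots> = ennreal \<epsilon>"
  proof (rule suminf_ennreal_eq)
    show "(\<lambda>n. \<epsilon> / 2 ^ Suc n) sums \<epsilon>"
      using sums_mult[OF power_half_series, of \<epsilon>] by (simp add: power_one_over field_simps)
  qed (use pos in auto)
  finally show "\<exists>W :: nat \<Rightarrow> 'a set. (\<Union>n. S n) \<subseteq> (\<Union>i. W i)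
      \<and> (\<forall>i. bounded (W i) \<and> diameter (W i) \<le> \<delta>) \<and> (\<Sum>i. diam_pow s (W i)) \<le> ennreal \<epsilon>"
    using cover U(2) by (intro exI[of _ V]) (auto simp: V_def split: prod.splits)
qed

lemma hausdorff_measure_null_Union:
  fixes S :: "'a::metric_space set set"
  assumes "countable S" and null: "\<And>T. T \<in> S \<Longrightarrow> hausdorff_measure s T = 0"
  shows "hausdorff_measure s (\<Union>S) = 0"
proof (cases "S = {}")
  case True
  have "\<exists>U :: nat \<Rightarrow> 'a set. {} \<subseteq> (\<Union>i. U i) \<and> (\<forall>i. bounded (U i) \<and> diameter (U i) \<le> \<delta>)
      \<and> (\<Sum>i. diam_pow s (U i)) \<le> ennreal \<epsilon>" if "\<delta> > 0" for \<delta> \<epsilon> :: real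
    using that by (intro exI[of _ "\<lambda>_. {}"]) (simp add: diam_pow_def)
  then show ?thesis unfolding hausdorff_measure_eq_0_iff hausdorff_content_eq_0_iff True by simp
next
  case False
  then have "hausdorff_measure s (\<Union>n. from_nat_into S n) = 0"
    by (intro hausdorff_measure_null_UN null from_nat_into)
  then show ?thesis using assms(1) False by (simp add: range_from_nat_into)
qed

lemma hausdorff_measure_null_if_finite_ball_covers:
  fixes S :: "real set"
  assumes "s > 0"
    and cov: "\<And>\<epsilon>. \<epsilon> > 0 \<Longrightarrow> \<exists>F r. finite F \<and> 0 \<le> r \<and> 2 * r \<le> \<epsilon> \<and> S \<subseteq> (\<Union>v\<in>F. cball v r)
                 \<and> card F * (2 * r) powr s \<le> \<epsilon>"
  shows "hausdorff_measure s S = 0"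
  unfolding hausdorff_measure_eq_0_iff hausdorff_content_eq_0_iff
proof (intro allI impI)
  fix \<delta> \<epsilon> :: real assume pos: "\<delta> > 0" "\<epsilon> > 0"
  obtain F r where F: "finite F" "0 \<le> r" "2 * r \<le> min \<delta> \<epsilon>" "S \<subseteq> (\<Union>v\<in>F. cball v r)"
      "card F * (2 * r) powr s \<le> min \<delta> \<epsilon>"
    using cov[of "min \<delta> \<epsilon>"] pos by auto
  define m where "m = card F"
  obtain h where h: "bij_betw h {0..<m} F"
    using ex_bij_betw_nat_finite[OF F(1)] unfolding m_def by blast
  define U where "U i = (if i < m then cball (h i) r else {})" for i
  have diam: "diameter (U i) \<le> 2 * r" for i
    using F(2) by (simp add: U_def)
  have "F = h ` {0..<m}" using h by (simp add: bij_betw_def)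
  then have "(\<Union>i. U i) = (\<Union>v\<in>F. cball v r)"
    by (auto simp: U_def split: if_splits)
  then have "S \<subseteq> (\<Union>i. U i)" using F(4) by simp
  moreover have "bounded (U i) \<and> diameter (U i) \<le> \<delta>" for i
    using diam[of i] F(3) by (auto simp: U_def)
  moreover have "(\<Sum>i. diam_pow s (U i)) \<le> ennreal \<epsilon>"
  proof -
    have "(\<Sum>i. diam_pow s (U i)) = (\<Sum>i<m. diam_pow s (U i))"
      by (rule suminf_finite) (auto simp: U_def diam_pow_def)
    also have "\<dots> \<le> (\<Sum>i<m. ennreal ((2 * r) powr s))"
      using \<open>s > 0\<close> diam F(2) by (intro sum_mono)
        (auto simp: diam_pow_def intro!: ennreal_leI powr_mono2 diameter_ge_0 simp: U_def)
    also have "\<dots> = ennreal (m * (2 * r) powr s)"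
      by (simp add: ennreal_mult ennreal_of_nat_eq_real_of_nat)
    also have "\<dots> \<le> ennreal \<epsilon>" using F(5) unfolding m_def by (intro ennreal_leI) simp
    finally show ?thesis .
  qed
  ultimately show "\<exists>U :: nat \<Rightarrow> real set. S \<subseteq> (\<Union>i. U i)
      \<and> (\<forall>i. bounded (U i) \<and> diameter (U i) \<le> \<delta>) \<and> (\<Sum>i. diam_pow s (U i)) \<le> ennreal \<epsilon>"
    by (intro exI[of _ U]) simp
qed

text \<open>The mass distribution principle in a form without measures on the fractal: a cover of
  \<open>range W\<close> with small \<open>s\<close>-sum would be carried by \<open>z\<close> to a cover of the unit interval of small
  Lebesgue measure. The map \<open>z\<close> plays the role of a distribution function on \<open>range W\<close>; both are
  given through a common parameter, so that \<open>W\<close> need not be inverted.\<close>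
lemma hausdorff_measure_pos_if_Holder_onto:
  fixes W :: "'b \<Rightarrow> 'a::metric_space" and z :: "'b \<Rightarrow> real"
  assumes Holder: "\<And>p q. \<bar>z p - z q\<bar> \<le> C * dist (W p) (W q) powr d"
    and onto: "{0..<1} \<subseteq> range z" and "0 \<le> s" "s \<le> d" "0 < C"
  shows "hausdorff_measure s (range W) \<noteq> 0"
proof
  assume "hausdorff_measure s (range W) = 0"
  then have "hausdorff_content s 1 (range W) = 0"
    by (simp add: hausdorff_measure_eq_0_iff)
  moreover have "1 / (4 * C) > 0" using \<open>0 < C\<close> by simp
  ultimately obtain U :: "nat \<Rightarrow> 'a set" where U: "range W \<subseteq> (\<Union>i. U i)"
      "\<And>i. bounded (U i) \<and> diameter (U i) \<le> 1"
      "(\<Sum>i. diam_pow s (U i)) \<le> ennreal (1 / (4 * C))"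
    unfolding hausdorff_content_eq_0_iff by blast
  define I where "I i = {p. W p \<in> U i}" for i
  define R where "R i = C * diameter (U i) powr d" for i
  define c where "c i = z (SOME p. p \<in> I i)" for i
  define J where "J i = (if I i = {} then {} else {c i - R i .. c i + R i})" for i
  have R0: "R i \<ge> 0" for i using \<open>0 < C\<close> by (simp add: R_def)
  have zJ: "z p \<in> J i" if "p \<in> I i" for p i
  proof -
    let ?q = "SOME p. p \<in> I i"
    have q: "?q \<in> I i" using that by (rule someI)
    have "dist (W p) (W ?q) \<le> diameter (U i)"
      using q that U(2) by (auto simp: I_def intro: diameter_bounded_bound)
    then have "C * dist (W p) (W ?q) powr d \<le> R i"
      unfolding R_def using \<open>0 < C\<close> assms(3,4) by (intro mult_left_mono powr_mono2) auto
    then have "\<bar>z p - c i\<bar> \<le> R i" using Holder[of p ?q] unfolding c_def by linarith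
    then show ?thesis using that by (auto simp: J_def)
  qed
  have sub: "{0..<1} \<subseteq> (\<Union>i. J i)"
  proof
    fix y :: real assume "y \<in> {0..<1}"
    then obtain p where "y = z p" using onto by blast
    moreover obtain i where "p \<in> I i" using U(1) by (auto simp: I_def)
    ultimately show "y \<in> (\<Union>i. J i)" using zJ by blast
  qed
  have Jm: "J i \<in> sets lborel" for i by (simp add: J_def)
  have eJ: "emeasure lborel (J i) \<le> ennreal (2 * C) * diam_pow s (U i)" for i
  proof (cases "I i = {}")
    case False
    then have ne: "U i \<noteq> {}" by (auto simp: I_def)
    have D: "0 \<le> diameter (U i)" "diameter (U i) \<le> 1" using U(2) by (auto intro: diameter_ge_0)
    have "emeasure lborel (J i) = ennreal (2 * R i)" using False R0[of i] by (simp add: J_def)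
    also have "\<dots> = ennreal (2 * C) * ennreal (diameter (U i) powr d)"
      using \<open>0 < C\<close> by (simp add: R_def ennreal_mult mult.assoc)
    also have "ennreal (diameter (U i) powr d) \<le> diam_pow s (U i)"
    proof (cases "s = 0")
      case True
      then show ?thesis using D assms(3,4) ne by (auto simp: diam_pow_def intro!: powr_le1)
    next
      case False
      then show ?thesis using D assms(3,4) ne
        by (cases "diameter (U i) = 0") (auto simp: diam_pow_def intro!: ennreal_leI powr_mono')
    qed
    finally show ?thesis by (simp add: mult_left_mono)
  qed (simp add: J_def)
  have "1 = emeasure lborel {0..<1::real}" by simp
  also have "\<dots> \<le> emeasure lborel (\<Union>i. J i)" using sub Jm by (intro emeasure_mono) auto
  also have "\<dots> \<le> (\<Sum>i. emeasure lborel (J i))"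
    using Jm by (intro emeasure_subadditive_countably) auto
  also have "\<dots> \<le> (\<Sum>i. ennreal (2 * C) * diam_pow s (U i))" by (intro suminf_le eJ) auto
  also have "\<dots> = ennreal (2 * C) * (\<Sum>i. diam_pow s (U i))" by simp
  also have "\<dots> \<le> ennreal (2 * C) * ennreal (1 / (4 * C))" by (intro mult_left_mono U(3)) auto
  also have "\<dots> = ennreal (1 / 2)" using \<open>0 < C\<close> by (simp flip: ennreal_mult')
  finally have "ennreal 1 \<le> ennreal (1 / 2)" by simp
  then show False by (subst (asm) ennreal_le_iff) auto
qed

lemma hausdorff_dim_eqI:
  assumes "d \<ge> 0" and above: "\<And>s. s > d \<Longrightarrow> hausdorff_measure s A = 0"
    and below: "\<And>s. 0 \<le> s \<Longrightarrow> s < d \<Longrightarrow> hausdorff_measure s A \<noteq> 0"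
  shows "hausdorff_dim A = ereal d"
  unfolding hausdorff_dim_def
proof (rule antisym)
  let ?S = "ereal ` {s. 0 \<le> s \<and> hausdorff_measure s A = 0}"
  show "Inf ?S \<le> ereal d"
  proof (rule ereal_le_epsilon2)
    fix e :: real assume "e > 0"
    then show "Inf ?S \<le> ereal d + ereal e"
      using above[of "d + e"] \<open>d \<ge> 0\<close> by (intro Inf_lower) auto
  qed
  show "ereal d \<le> Inf ?S"
    using below by (intro Inf_greatest) (force simp: not_less)
qed

text \<open>Here \<open>fact n\<close> and \<open>fact (Suc n)\<close> are the ends of a block. Because
  \<open>fact n = fact (Suc n) / (n + 1)\<close>, the summand \<open>l * fact n\<close> is negligible against
  \<open>(s - d) * fact (Suc n)\<close> for every constant \<open>l\<close>; it is therefore harmless that \<open>l\<close> will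
  depend on the number of terms of a linear combination.\<close>
lemma null_if_block_covers:
  fixes S :: "real set"
  assumes "0 \<le> d" "d < s" "0 \<le> C" "0 \<le> D"
    and cov: "\<And>m. \<exists>n\<ge>m. \<exists>F. finite F \<and> card F \<le> C * 2 powr (l * fact n + d * fact (Suc n))
      \<and> S \<subseteq> (\<Union>v\<in>F. cball v (D * ((fact (Suc n) + 2) / 2 ^ fact (Suc n))))"
  shows "hausdorff_measure s S = 0"
proof (rule hausdorff_measure_null_if_finite_ball_covers)
  show "s > 0" using assms by simp
  fix \<epsilon> :: real assume "\<epsilon> > 0"
  \<comment> \<open>Half of \<open>s - d\<close> absorbs \<open>l * fact n\<close>, the other half makes the bound tend to 0.\<close>
  define e where "e = (s - d) / 2"
  have e: "e > 0" using assms by (simp add: e_def)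
  define \<phi> where "\<phi> x = C * (2 * D) powr s * ((x + 2) powr s * 2 powr (- e * x))" for x :: real
  define \<psi> where "\<psi> x = 2 * D * ((x + 2) * 2 powr (- x))" for x :: real
  have "((\<lambda>x::real. (x + 2) powr s * 2 powr (- e * x)) \<longlongrightarrow> 0) at_top"
    using e \<open>s > 0\<close> by real_asymp
  then have "(\<phi> \<longlongrightarrow> 0) at_top" unfolding \<phi>_def by (rule tendsto_mult_right_zero)
  then have 1: "\<forall>\<^sub>F x in at_top. \<phi> x < \<epsilon>" using \<open>\<epsilon> > 0\<close> by (rule order_tendstoD)
  have "((\<lambda>x::real. (x + 2) * 2 powr (- x)) \<longlongrightarrow> 0) at_top" by real_asymp
  then have "(\<psi> \<longlongrightarrow> 0) at_top" unfolding \<psi>_def by (rule tendsto_mult_right_zero)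
  then have 2: "\<forall>\<^sub>F x in at_top. \<psi> x < \<epsilon>" using \<open>\<epsilon> > 0\<close> by (rule order_tendstoD)
  obtain x0 where x0: "\<And>x. x \<ge> x0 \<Longrightarrow> \<phi> x < \<epsilon> \<and> \<psi> x < \<epsilon>"
    using eventually_conj[OF 1 2] unfolding eventually_at_top_linorder by blast
  obtain n F where n: "n \<ge> nat \<lceil>x0\<rceil> + nat \<lceil>l / e\<rceil>" and F: "finite F"
      "card F \<le> C * 2 powr (l * fact n + d * fact (Suc n))"
      "S \<subseteq> (\<Union>v\<in>F. cball v (D * ((fact (Suc n) + 2) / 2 ^ fact (Suc n))))"
    using cov[of "nat \<lceil>x0\<rceil> + nat \<lceil>l / e\<rceil>"] by blast
  define M where "M = real (fact (Suc n))"
  define r where "r = D * ((fact (Suc n) + 2) / 2 ^ fact (Suc n))"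
  have r: "r = D * ((M + 2) * 2 powr (- M))"
    unfolding r_def M_def powr_minus powr_realpow[OF zero_less_numeral]
    by (simp add: divide_inverse del: fact_Suc)
  have M0: "M > 0" by (simp add: M_def del: fact_Suc)
  have "n \<le> fact (Suc n)" using fact_ge_self[of "Suc n"] by linarith
  then have "x0 \<le> M" using n unfolding M_def by linarith
  then have small: "\<phi> M < \<epsilon>" "\<psi> M < \<epsilon>" using x0 by auto
  have "l / e \<le> real n + 1" using n by linarith
  then have "l \<le> e * (real n + 1)" using e by (simp add: field_simps)
  then have "l * fact n \<le> e * (real n + 1) * fact n" by (rule mult_right_mono) simp
  also have "\<dots> = e * M" by (simp add: M_def algebra_simps)
  finally have lM: "l * fact n \<le> e * M" .
  have r_pow: "(2 * r) powr s = (2 * D) powr s * ((M + 2) powr s * 2 powr (- (s * M)))"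
  proof -
    have "2 * r = (2 * D) * ((M + 2) * 2 powr (- M))" by (simp add: r)
    then show ?thesis using assms(4) M0
      by (simp only: powr_mult powr_powr) (simp add: powr_mult powr_powr mult.commute)
  qed
  have "card F * (2 * r) powr s \<le> C * 2 powr (e * M + d * M) * (2 * r) powr s"
  proof (rule mult_right_mono)
    have "real (card F) \<le> C * 2 powr (l * fact n + d * M)"
      using F(2) unfolding M_def of_nat_fact .
    also have "\<dots> \<le> C * 2 powr (e * M + d * M)"
      using lM assms(3) by (intro mult_left_mono powr_mono) auto
    finally show "real (card F) \<le> C * 2 powr (e * M + d * M)" .
  qed simp
  also have "\<dots> = C * (2 * D) powr s * ((M + 2) powr s * (2 powr (e * M + d * M) * 2 powr (- (s * M))))"
    unfolding r_pow by (simp add: algebra_simps)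
  also have "2 powr (e * M + d * M) * 2 powr (- (s * M)) = 2 powr (- e * M)"
  proof -
    have "e * M + d * M + - (s * M) = - e * M" unfolding e_def by (simp add: field_simps)
    then show ?thesis unfolding powr_add[symmetric] by (simp only:)
  qed
  also have "C * (2 * D) powr s * ((M + 2) powr s * 2 powr (- e * M)) = \<phi> M" by (simp add: \<phi>_def)
  finally have "card F * (2 * r) powr s \<le> \<epsilon>" using small by simp
  moreover have "2 * r \<le> \<epsilon>" using small(2) by (simp add: \<psi>_def r)
  moreover have "0 \<le> r" using assms(4) M0 by (simp add: r)
  ultimately show "\<exists>F r. finite F \<and> 0 \<le> r \<and> 2 * r \<le> \<epsilon> \<and> S \<subseteq> (\<Union>v\<in>F. cball v r)
      \<and> card F * (2 * r) powr s \<le> \<epsilon>"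
    using F(1,3) unfolding r_def by blast
qed

section \<open>Binary digits at prescribed positions\<close>

lemma binary_expansion_exists:
  fixes y :: real
  assumes "0 \<le> y" "y < 1"
  shows "\<exists>\<omega> :: nat \<Rightarrow> bool. (\<lambda>i. of_bool (\<omega> i) / 2 ^ Suc i) sums y"
proof -
  define \<omega> where "\<omega> i = odd \<lfloor>2 ^ Suc i * y\<rfloor>" for i
  have digit: "of_int \<lfloor>2 ^ Suc i * y\<rfloor> = 2 * of_int \<lfloor>2 ^ i * y\<rfloor> + (of_bool (\<omega> i) :: real)" for i
  proof -
    have "\<lfloor>2 ^ i * y\<rfloor> = \<lfloor>2 ^ Suc i * y\<rfloor> div 2"
      using floor_divide_real_eq_div[of 2 "2 ^ Suc i * y"] by simp
    moreover have "q = 2 * (q div 2) + of_bool (odd q)" for q :: int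
      by (cases "odd q") simp_all
    ultimately have "\<lfloor>2 ^ Suc i * y\<rfloor> = 2 * \<lfloor>2 ^ i * y\<rfloor> + of_bool (\<omega> i)"
      unfolding \<omega>_def by metis
    then show ?thesis by simp
  qed
  have partial: "(\<Sum>i<n. (of_bool (\<omega> i) :: real) / 2 ^ Suc i) = of_int \<lfloor>2 ^ n * y\<rfloor> / 2 ^ n" for n
  proof (induction n)
    case 0
    have "\<lfloor>y\<rfloor> = 0" using assms by linarith
    then show ?case by simp
  next
    case (Suc n)
    then show ?case using digit[of n] by (simp add: field_simps)
  qed
  have "(\<lambda>n. of_int \<lfloor>2 ^ n * y\<rfloor> / 2 ^ n) \<longlonglongrightarrow> y"
  proof (rule tendsto_sandwich)
    show "\<forall>\<^sub>F n in sequentially. y - (1 / 2) ^ n \<le> of_int \<lfloor>2 ^ n * y\<rfloor> / 2 ^ n"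
    proof (intro always_eventually allI)
      fix n
      have "2 ^ n * y \<le> of_int \<lfloor>2 ^ n * y\<rfloor> + 1" by linarith
      then have "y \<le> (of_int \<lfloor>2 ^ n * y\<rfloor> + 1) / 2 ^ n"
        by (simp add: pos_le_divide_eq mult.commute)
      then show "y - (1 / 2) ^ n \<le> of_int \<lfloor>2 ^ n * y\<rfloor> / 2 ^ n"
        by (simp add: add_divide_distrib power_one_over)
    qed
    show "\<forall>\<^sub>F n in sequentially. of_int \<lfloor>2 ^ n * y\<rfloor> / 2 ^ n \<le> y"
      by (intro always_eventually allI) (simp add: field_simps)
    have "(\<lambda>n. y - (1 / 2) ^ n) \<longlonglongrightarrow> y - 0"
      by (intro tendsto_intros LIMSEQ_power_zero) simp
    then show "(\<lambda>n. y - (1 / 2) ^ n) \<longlonglongrightarrow> y" by simp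
  qed simp
  then have "(\<lambda>i. of_bool (\<omega> i) / 2 ^ Suc i) sums y"
    unfolding sums_def partial .
  then show ?thesis by blast
qed

definition binary :: "(nat \<Rightarrow> nat) \<Rightarrow> (nat \<Rightarrow> bool) \<Rightarrow> real" where
  "binary a \<omega> = (\<Sum>j. of_bool (\<omega> j) / 2 ^ Suc (a j))"

lemma tail_geometric: "(\<lambda>i. 1 / 2 ^ Suc (i + n) :: real) sums (1 / 2 ^ n)"
  using sums_mult[OF power_half_series, of "1 / 2 ^ n"]
  by (simp add: power_add power_one_over field_simps)

lemma strict_mono_add_le:
  fixes a :: "nat \<Rightarrow> nat"
  assumes "strict_mono a" shows "a j + i \<le> a (j + i)"
proof (induction i)
  case (Suc i)
  have "a (j + i) < a (j + Suc i)" using assms by (auto intro: strict_monoD)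
  then show ?case using Suc by simp
qed simp

lemma strict_mono_geometric_tail:
  assumes "strict_mono a"
  shows "summable (\<lambda>i. 1 / 2 ^ Suc (a (i + k)) :: real)"
    and "(\<Sum>i. 1 / 2 ^ Suc (a (i + k)) :: real) \<le> 1 / 2 ^ a k"
proof -
  have le: "1 / 2 ^ Suc (a (i + k)) \<le> (1 / 2 ^ Suc (i + a k) :: real)" for i
    using strict_mono_add_le[OF assms, of k i]
    by (intro divide_left_mono power_increasing) (auto simp: add.commute)
  show *: "summable (\<lambda>i. 1 / 2 ^ Suc (a (i + k)) :: real)"
    by (rule summable_comparison_test'[OF sums_summable[OF tail_geometric[of "a k"]]])
      (use le in auto)
  show "(\<Sum>i. 1 / 2 ^ Suc (a (i + k)) :: real) \<le> 1 / 2 ^ a k"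
    using suminf_le[OF le * sums_summable[OF tail_geometric]] sums_unique[OF tail_geometric] by simp
qed

lemma summable_binary:
  assumes "strict_mono a"
  shows "summable (\<lambda>j. of_bool (\<omega> j) / 2 ^ Suc (a j) :: real)"
  by (rule summable_comparison_test'[OF strict_mono_geometric_tail(1)[OF assms, of 0]]) auto

lemma range_binary_id: "{0..<1} \<subseteq> range (binary id)"
proof
  fix y :: real assume "y \<in> {0..<1}"
  then obtain \<omega> :: "nat \<Rightarrow> bool" where "(\<lambda>i. of_bool (\<omega> i) / 2 ^ Suc i) sums y"
    using binary_expansion_exists by auto
  then show "y \<in> range (binary id)" by (auto simp: binary_def sums_iff)
qed

text \<open>Let \<open>j\<close> be the first position where two digit sequences differ. Writing
  \<open>\<omega>'\<^sub>i - \<omega>\<^sub>i = (1 + \<omega>'\<^sub>i - \<omega>\<^sub>i) - 1\<close> for \<open>i > j\<close> makes all later coefficients nonnegative, and the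
  subtracted terms sum up to at most the leading difference at \<open>j\<close>. This avoids any discussion of
  carries. For consecutive positions the cancellation is exact.\<close>
lemma binary_diff_ge:
  assumes a: "strict_mono a" and first: "\<forall>i<j. \<omega> i = \<omega>' i" "\<not> \<omega> j" "\<omega>' j"
  shows "binary id \<omega>' - binary id \<omega>
           = (\<Sum>i. (1 + of_bool (\<omega>' (i + Suc j)) - of_bool (\<omega> (i + Suc j))) / 2 ^ Suc (i + Suc j))"
    and "binary a \<omega>' - binary a \<omega>
           \<ge> (\<Sum>i. (1 + of_bool (\<omega>' (i + Suc j)) - of_bool (\<omega> (i + Suc j))) / 2 ^ Suc (a (i + Suc j)))"
proof -
  have split: "binary a \<omega>' - binary a \<omega>
     = 1 / 2 ^ Suc (a j) - (\<Sum>i. 1 / 2 ^ Suc (a (i + Suc j)))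
       + (\<Sum>i. (1 + of_bool (\<omega>' (i + Suc j)) - of_bool (\<omega> (i + Suc j))) / 2 ^ Suc (a (i + Suc j)))"
    if a: "strict_mono a" for a
  proof -
    define f :: "nat \<Rightarrow> real" where "f i = (of_bool (\<omega>' i) - of_bool (\<omega> i)) / 2 ^ Suc (a i)" for i
    define g :: "nat \<Rightarrow> real" where "g i = 1 / 2 ^ Suc (a i)" for i
    have f: "summable f" unfolding f_def diff_divide_distrib
      by (intro summable_diff summable_binary a)
    have g: "summable (\<lambda>i. g (i + Suc j))" unfolding g_def
      by (rule strict_mono_geometric_tail(1)[OF a])
    have f': "summable (\<lambda>i. f (i + Suc j))"
      using f by (subst summable_iff_shift)
    have "binary a \<omega>' - binary a \<omega> = suminf f"
      unfolding binary_def f_def diff_divide_distrib by (intro suminf_diff summable_binary a)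
    also have "\<dots> = (\<Sum>i. f (i + Suc j)) + sum f {..<Suc j}"
      by (rule suminf_split_initial_segment[OF f])
    also have "sum f {..<Suc j} = 1 / 2 ^ Suc (a j)"
      using first by (simp add: f_def)
    also have "(\<Sum>i. f (i + Suc j)) = (\<Sum>i. g (i + Suc j) + f (i + Suc j)) - (\<Sum>i. g (i + Suc j))"
      using suminf_add[OF g f'] by simp
    finally show ?thesis
      by (simp add: f_def g_def add_divide_distrib diff_divide_distrib algebra_simps)
  qed
  have "(\<Sum>i. 1 / 2 ^ Suc (id (i + Suc j)) :: real) = 1 / 2 ^ Suc (id j)"
    using sums_unique[OF tail_geometric[of "Suc j"]] by simp
  then show "binary id \<omega>' - binary id \<omega>
           = (\<Sum>i. (1 + of_bool (\<omega>' (i + Suc j)) - of_bool (\<omega> (i + Suc j))) / 2 ^ Suc (i + Suc j))"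
    using split[of id] by (simp add: strict_mono_id)
  have "(\<Sum>i. 1 / 2 ^ Suc (a (i + Suc j)) :: real) \<le> 1 / 2 ^ a (Suc j)"
    by (rule strict_mono_geometric_tail(2)[OF a])
  also have "\<dots> \<le> 1 / 2 ^ Suc (a j)"
    using strict_mono_add_le[OF a, of j 1] by (intro divide_left_mono power_increasing) auto
  finally show "binary a \<omega>' - binary a \<omega>
           \<ge> (\<Sum>i. (1 + of_bool (\<omega>' (i + Suc j)) - of_bool (\<omega> (i + Suc j))) / 2 ^ Suc (a (i + Suc j)))"
    using split[OF a] by simp
qed

text \<open>By the preceding lemma, both differences are controlled by the first index \<open>I > j\<close> at which
  \<open>1 + \<omega>'\<^sub>i - \<omega>\<^sub>i\<close> does not vanish: the difference without gaps is at most \<open>2 / 2 ^ I\<close>, and the one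
  with gaps is at least \<open>1 / 2 ^ Suc (a I)\<close>, where \<open>a I\<close> is at most \<open>I / d\<close> up to a constant.\<close>
lemma binary_Holder_ordered:
  fixes c d :: real
  assumes a: "strict_mono a" and d: "0 < d" and slow: "\<And>j. real (a j) \<le> real j / d + c"
    and first: "\<forall>i<j. \<omega> i = \<omega>' i" "\<not> \<omega> j" "\<omega>' j"
  shows "\<bar>binary id \<omega>' - binary id \<omega>\<bar>
           \<le> 2 * 2 powr (d * (c + 1)) * \<bar>binary a \<omega>' - binary a \<omega>\<bar> powr d"
proof -
  define \<delta> :: "nat \<Rightarrow> real" where "\<delta> i = 1 + of_bool (\<omega>' i) - of_bool (\<omega> i)" for i
  have \<delta>: "0 \<le> \<delta> i" "\<delta> i \<le> 2" "\<delta> i \<noteq> 0 \<Longrightarrow> 1 \<le> \<delta> i" for i by (auto simp: \<delta>_def)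
  have sm: "summable (\<lambda>i. \<delta> (i + k) / 2 ^ Suc (b (i + k)))" if "strict_mono b" for b k
  proof (rule summable_comparison_test'[OF summable_mult[OF strict_mono_geometric_tail(1)[OF that, of k], of 2]])
    show "norm (\<delta> (i + k) / 2 ^ Suc (b (i + k))) \<le> 2 * (1 / 2 ^ Suc (b (i + k)))" for i
      using \<delta>[of "i + k"] by (simp add: field_simps)
  qed
  note D = binary_diff_ge[OF a first, folded \<delta>_def]
  show ?thesis
  proof (cases "\<exists>i>j. \<delta> i \<noteq> 0")
    case False
    then have "binary id \<omega>' - binary id \<omega> = 0" unfolding D(1) by simp
    then show ?thesis by simp
  next
    case True
    define I where "I = (LEAST i. i > j \<and> \<delta> i \<noteq> 0)"
    have I: "I > j" "\<delta> I \<noteq> 0" using LeastI_ex[of "\<lambda>i. i > j \<and> \<delta> i \<noteq> 0"] True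
      unfolding I_def by auto
    have before: "\<delta> i = 0" if "j < i" "i < I" for i
      using not_less_Least[of i "\<lambda>i. i > j \<and> \<delta> i \<noteq> 0"] that unfolding I_def by blast
    obtain k where k: "I = k + Suc j" using I(1) using less_imp_Suc_add[of j I] by auto
    have sid: "summable (\<lambda>i. \<delta> (i + Suc j) / 2 ^ Suc (i + Suc j))"
      using sm[OF strict_mono_id, of "Suc j"] by simp
    have "binary id \<omega>' - binary id \<omega> = (\<Sum>i. \<delta> (i + k + Suc j) / 2 ^ Suc (i + k + Suc j))
        + (\<Sum>i<k. \<delta> (i + Suc j) / 2 ^ Suc (i + Suc j))"
      unfolding D(1) using suminf_split_initial_segment[OF sid, of k] by simp
    also have "(\<Sum>i<k. \<delta> (i + Suc j) / 2 ^ Suc (i + Suc j)) = 0"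
      using before k by (intro sum.neutral) auto
    also have "(\<Sum>i. \<delta> (i + k + Suc j) / 2 ^ Suc (i + k + Suc j)) \<le> (\<Sum>i. 2 * (1 / 2 ^ Suc (i + I)))"
    proof (rule suminf_le)
      show "summable (\<lambda>i. \<delta> (i + k + Suc j) / 2 ^ Suc (i + k + Suc j))"
        using sm[OF strict_mono_id, of I] by (simp add: k add.assoc)
      show "summable (\<lambda>i. 2 * (1 / 2 ^ Suc (i + I)) :: real)"
        by (intro summable_mult sums_summable[OF tail_geometric])
      show "\<delta> (i + k + Suc j) / 2 ^ Suc (i + k + Suc j) \<le> 2 * (1 / 2 ^ Suc (i + I))" for i
        using divide_right_mono[OF \<delta>(2)[of "i + k + Suc j"], of "2 ^ Suc (i + k + Suc j)"]
        by (simp add: k add.assoc)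
    qed
    also have "\<dots> = 2 * (1 / 2 ^ I)"
      by (rule sums_unique[OF sums_mult[OF tail_geometric], symmetric])
    finally have up: "binary id \<omega>' - binary id \<omega> \<le> 2 * (1 / 2 ^ I)"
      by (simp only: add_0_right)
    have "1 / 2 ^ Suc (a I) \<le> \<delta> (k + Suc j) / 2 ^ Suc (a (k + Suc j))"
      unfolding k[symmetric] using \<delta>(3)[OF I(2)] by (intro divide_right_mono) auto
    also have "\<dots> \<le> (\<Sum>i. \<delta> (i + Suc j) / 2 ^ Suc (a (i + Suc j)))"
      using sum_le_suminf[OF sm[OF a, of "Suc j"], of "{k}"] \<delta>(1) by simp
    also have "\<dots> \<le> binary a \<omega>' - binary a \<omega>" by (rule D(2))
    finally have low: "1 / 2 ^ Suc (a I) \<le> binary a \<omega>' - binary a \<omega>" .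
    have nonneg: "0 \<le> binary id \<omega>' - binary id \<omega>"
      unfolding D(1) using \<delta>(1) sid by (intro suminf_nonneg) auto
    have "1 / 2 ^ I = 2 powr (- (d * (real I / d)))"
      using d by (simp add: powr_minus_divide powr_realpow)
    also have "\<dots> \<le> 2 powr (d * (c + 1) + - (d * real (Suc (a I))))"
      using slow[of I] d by (intro powr_mono) (auto simp: field_simps)
    also have "\<dots> = 2 powr (d * (c + 1)) * (2 powr (- real (Suc (a I)))) powr d"
      by (simp only: powr_add powr_powr) (simp add: algebra_simps)
    also have "2 powr (- real (Suc (a I))) = 1 / 2 ^ Suc (a I)"
      
      by (subst powr_minus_divide) (simp add: powr_add powr_realpow)
    also have "2 powr (d * (c + 1)) * (1 / 2 ^ Suc (a I)) powr d
        \<le> 2 powr (d * (c + 1)) * (binary a \<omega>' - binary a \<omega>) powr d"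
      using low d by (intro mult_left_mono powr_mono2) auto
    finally have "1 / 2 ^ I \<le> 2 powr (d * (c + 1)) * (binary a \<omega>' - binary a \<omega>) powr d" .
    moreover have "0 \<le> binary a \<omega>' - binary a \<omega>" using order_trans[OF _ low, of 0] by simp
    ultimately show ?thesis using up nonneg by simp
  qed
qed

lemma binary_Holder:
  fixes c d :: real
  assumes a: "strict_mono a" and d: "0 < d" and slow: "\<And>j. real (a j) \<le> real j / d + c"
  shows "\<bar>binary id \<omega> - binary id \<omega>'\<bar>
           \<le> 2 * 2 powr (d * (c + 1)) * dist (binary a \<omega>) (binary a \<omega>') powr d"
proof (cases "\<omega> = \<omega>'")
  case False
  define j where "j = (LEAST j. \<omega> j \<noteq> \<omega>' j)"
  have j: "\<omega> j \<noteq> \<omega>' j" 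
  proof -
    from False have "\<exists>j. \<omega> j \<noteq> \<omega>' j" by (simp add: fun_eq_iff)
    from LeastI_ex[OF this] show ?thesis unfolding j_def .
  qed
  have eq: "\<omega> i = \<omega>' i" if "i < j" for i
    using not_less_Least[of i "\<lambda>j. \<omega> j \<noteq> \<omega>' j"] that unfolding j_def by blast
  show ?thesis
  proof (cases "\<omega> j")
    case True
    then show ?thesis
      using binary_Holder_ordered[OF a d slow, of j \<omega>' \<omega>] j eq by (simp add: dist_real_def)
  next
    case False
    then show ?thesis
      using binary_Holder_ordered[OF a d slow, of j \<omega> \<omega>'] j eq
      by (simp add: dist_real_def abs_minus_commute)
  qed
qed simp

text \<open>The positions below \<open>M\<close> all lie below \<open>K\<close>, so truncating at \<open>M\<close> gives a dyadic number with
  denominator \<open>2 ^ K\<close>. What matters later is that these truncations lie in an arithmetic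
  progression: the number of their rational combinations grows only like \<open>2 ^ K\<close>, however many
  summands there are.\<close>
lemma binary_dyadic_approx:
  assumes a: "strict_mono a" and gap: "\<And>j. a j < M \<Longrightarrow> Suc (a j) \<le> K"
  shows "\<exists>h :: int. 0 \<le> h \<and> h \<le> 2 ^ K \<and> \<bar>binary a \<omega> - of_int h / 2 ^ K\<bar> \<le> 1 / 2 ^ M"
proof -
  define k where "k = (LEAST k. M \<le> a k)"
  have "M \<le> a M" using strict_mono_add_le[OF a, of 0 M] by simp
  then have k: "M \<le> a k" unfolding k_def by (rule LeastI)
  have below: "a j < M" if "j < k" for j
    using not_less_Least[of j "\<lambda>k. M \<le> a k"] that unfolding k_def by simp
  let ?f = "\<lambda>j. of_bool (\<omega> j) / 2 ^ Suc (a j) :: real"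
  define h :: int where "h = (\<Sum>j<k. of_bool (\<omega> j) * 2 ^ (K - Suc (a j)))"
  have "of_int h / 2 ^ K = (\<Sum>j<k. (of_bool (\<omega> j) * 2 ^ (K - Suc (a j))) / 2 ^ K :: real)"
    unfolding h_def of_int_sum sum_divide_distrib of_int_mult of_int_of_bool of_int_power of_int_numeral ..
  also have "\<dots> = sum ?f {..<k}"
  proof (rule sum.cong[OF refl])
    fix j assume "j \<in> {..<k}"
    then have "Suc (a j) \<le> K" using below gap by auto
    then show "(of_bool (\<omega> j) * 2 ^ (K - Suc (a j))) / 2 ^ K = ?f j"
      by (simp add: power_diff field_simps del: power_Suc)
  qed
  finally have h: "of_int h / 2 ^ K = sum ?f {..<k}" .
  have "sum ?f {..<k} \<le> (\<Sum>j. ?f j)"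
    by (intro sum_le_suminf summable_binary a) auto
  also have "\<dots> \<le> (\<Sum>j. 1 / 2 ^ Suc (a (j + 0)))"
    by (intro suminf_le summable_binary a strict_mono_geometric_tail(1)[OF a]) simp
  also have "\<dots> \<le> 1 / 2 ^ a 0" by (rule strict_mono_geometric_tail(2)[OF a])
  also have "\<dots> \<le> 1" by simp
  finally have "of_int h / (2 ^ K :: real) \<le> 1" unfolding h .
  then have "real_of_int h \<le> of_int (2 ^ K)" by (simp add: divide_le_eq)
  then have "h \<le> 2 ^ K" by (simp only: of_int_le_iff)
  moreover have "0 \<le> h" unfolding h_def by (intro sum_nonneg) auto
  moreover have "\<bar>binary a \<omega> - of_int h / 2 ^ K\<bar> \<le> 1 / 2 ^ M"
  proof -
    have sm: "summable (\<lambda>j. ?f (j + k))"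
      using summable_binary[OF a, of \<omega>] by (subst summable_iff_shift)
    have eq: "binary a \<omega> - of_int h / 2 ^ K = (\<Sum>j. ?f (j + k))"
      unfolding h binary_def using suminf_split_initial_segment[OF summable_binary[OF a, of \<omega>], of k] by simp
    have "(\<Sum>j. ?f (j + k)) \<le> (\<Sum>j. 1 / 2 ^ Suc (a (j + k)))"
      by (intro suminf_le sm strict_mono_geometric_tail(1)[OF a]) simp
    also have "\<dots> \<le> 1 / 2 ^ a k" by (rule strict_mono_geometric_tail(2)[OF a])
    also have "\<dots> \<le> 1 / 2 ^ M" using k by (intro divide_left_mono power_increasing) auto
    finally have "(\<Sum>j. ?f (j + k)) \<le> 1 / 2 ^ M" .
    moreover have "0 \<le> (\<Sum>j. ?f (j + k))" by (intro suminf_nonneg sm) auto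
    ultimately show ?thesis unfolding eq by simp
  qed
  ultimately show ?thesis by blast
qed

text \<open>For \<open>d > 0\<close>, before \<open>fact n\<close> there are to be exactly \<open>h (fact n) = \<lfloor>d * fact n\<rfloor>\<close> positions, and hence
  \<open>g (fact n) = fact n - h (fact n)\<close> omitted numbers. The \<open>j\<close>-th position is therefore \<open>j\<close> plus the number of
  omissions before the last block whose first position has an index at most \<open>j\<close>; that there is a last
  one needs \<open>d > 0\<close>. Monotonicity of \<open>g\<close> is where \<open>d < 1\<close> enters. For \<open>d = 0\<close> the
  factorials are sparse enough.\<close>
lemma gapped_positions_exist:
  fixes d :: real
  assumes "0 \<le> d" "d < 1"
  shows "\<exists>a :: nat \<Rightarrow> nat. strict_mono a
     \<and> (\<forall>n j. a j < fact (Suc n) \<longrightarrow> real (a j) \<le> d * fact (Suc n) + fact n)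
     \<and> (0 < d \<longrightarrow> (\<exists>c. \<forall>j. real (a j) \<le> real j / d + c))"
proof (cases "d = 0")
  case True
  have "strict_mono (\<lambda>j. fact (Suc j) :: nat)"
    by (intro strict_monoI fact_less_mono_nat) auto
  moreover have "real (fact (Suc j)) \<le> fact n" if "fact (Suc j) < (fact (Suc n) :: nat)" for n j
  proof -
    have "j < n" using that fact_mono_nat[of "Suc n" "Suc j"] by (metis not_less Suc_le_mono)
    then show ?thesis by (metis Suc_leI fact_mono of_nat_fact)
  qed
  ultimately show ?thesis using True by (intro exI[of _ "\<lambda>j. fact (Suc j)"]) auto
next
  case False
  then have d: "0 < d" using assms by simp
  define h where "h x = nat \<lfloor>d * real x\<rfloor>" for x :: nat
  define g where "g x = x - h x" for x
  have h: "real (h x) \<le> d * real x" "d * real x < real (h x) + 1" for x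
    unfolding h_def using d by (simp_all add: of_nat_nat)
  have hx: "h x \<le> x" for x
  proof -
    have "d * real x \<le> 1 * real x" using assms by (intro mult_right_mono) auto
    then show ?thesis using h(1)[of x] by linarith
  qed
  then have gh: "h x + g x = x" for x by (simp add: g_def)
  have h_mono: "h x \<le> h y" if "x \<le> y" for x y
    unfolding h_def using that d by (intro nat_mono floor_mono mult_left_mono) auto
  have g_mono: "g x \<le> g y" if "x \<le> y" for x y
  proof -
    have "d * (real y - real x) \<le> 1 * (real y - real x)"
      using that assms by (intro mult_right_mono) auto
    then have "real (h y) < real (h x) + 1 + (real y - real x)"
      using h[of x] h(1)[of y] by (simp add: algebra_simps)
    then have "h y \<le> h x + (y - x)" using that by linarith
    then show ?thesis using gh[of x] gh[of y] that by linarith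
  qed
  define S where "S j = {n. h (fact n) \<le> j}" for j
  have fin: "finite (S j)" for j
  proof (rule finite_subset)
    show "S j \<subseteq> {.. nat \<lceil>(real j + 1) / d\<rceil>}"
    proof
      fix n assume "n \<in> S j"
      then have "d * real (fact n) \<le> real j + 1" using h(2)[of "fact n"] unfolding S_def by simp
      then have "real (fact n) \<le> (real j + 1) / d" using d by (simp add: field_simps)
      moreover have "real n \<le> real (fact n)" by (simp only: of_nat_le_iff fact_ge_self)
      ultimately show "n \<in> {.. nat \<lceil>(real j + 1) / d\<rceil>}" by simp linarith
    qed
  qed simp
  have "h (fact 0) = 0" using assms by (simp add: h_def)
  then have ne: "S j \<noteq> {}" for j unfolding S_def by (metis (mono_tags) empty_iff mem_Collect_eq zero_le)
  define N where "N j = Max (S j)" for j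
  have N: "h (fact (N j)) \<le> j" for j using Max_in[OF fin ne, of j] unfolding N_def S_def by simp
  have N_ge: "n \<le> N j" if "h (fact n) \<le> j" for n j
    unfolding N_def using that by (intro Max_ge fin) (simp add: S_def)
  define a where "a j = j + g (fact (N j))" for j
  have "strict_mono a"
  proof (rule strict_monoI)
    fix i j :: nat assume "i < j"
    then have "N i \<le> N j" using N[of i] by (intro N_ge) simp
    then show "a i < a j" unfolding a_def
      using \<open>i < j\<close> by (intro add_less_le_mono g_mono fact_mono_nat) auto
  qed
  moreover have "real (a j) \<le> d * fact (Suc n) + fact n" if less: "a j < fact (Suc n)" for n j
  proof -
    have j: "j < h (fact (Suc n))"
    proof (rule ccontr)
      assume "\<not> j < h (fact (Suc n))"
      then have "h (fact (Suc n)) \<le> j" "g (fact (Suc n)) \<le> g (fact (N j))"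
        using N_ge[of "Suc n" j] by (auto intro!: g_mono fact_mono_nat simp del: fact_Suc)
      then show False using less gh[of "fact (Suc n)"] unfolding a_def by linarith
    qed
    have "N j \<le> n"
    proof (rule ccontr)
      assume "\<not> N j \<le> n"
      then have "h (fact (Suc n)) \<le> h (fact (N j))" by (intro h_mono fact_mono_nat) simp
      then show False using N[of j] j by linarith
    qed
    then have "g (fact (N j)) \<le> fact n"
      using gh[of "fact (N j)"] fact_mono_nat[of "N j" n] by linarith
    then have "real (a j) \<le> real (h (fact (Suc n))) + real (fact n)"
      using j unfolding a_def by linarith
    then show ?thesis using h(1)[of "fact (Suc n)"] by (simp only: of_nat_fact)
  qed
  moreover have "real (a j) \<le> real j / d + 1 / d" for j
  proof -
    define x :: nat where "x = fact (N j)"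
    have "d * real x \<le> real j + 1" using h(2)[of x] N[of j] unfolding x_def[symmetric] by linarith
    then have "real x * (1 - d) \<le> ((real j + 1) / d) * (1 - d)"
      using d assms by (intro mult_right_mono) (auto simp: field_simps)
    moreover have "real (g x) \<le> real x * (1 - d) + 1"
      using gh[of x] h(2)[of x] by (simp add: algebra_simps g_def of_nat_diff hx)
    moreover have "((real j + 1) / d) * (1 - d) = real j / d + 1 / d - real j - 1"
      using d by (simp add: field_simps)
    ultimately show ?thesis unfolding a_def x_def[symmetric] by simp
  qed
  ultimately show ?thesis by blast
qed

section \<open>Continuity and compactness on the Cantor space\<close>

lemma compact_UNIV_fun:
  assumes "compact (UNIV :: 'b::topological_space set)"
  shows "compact (UNIV :: ('a \<Rightarrow> 'b) set)"
proof -
  have "compact_space (euclidean :: 'b topology)" using assms by (simp add: compact_space_def)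
  then have "compact_space (product_topology (\<lambda>i::'a. euclidean :: 'b topology) UNIV)"
    unfolding compact_space_product_topology by blast
  then show ?thesis unfolding euclidean_product_topology by (simp add: compact_space_def)
qed

lemma compact_UNIV_bool: "compact (UNIV :: bool set)"
  by (intro finite_imp_compact) simp

lemma open_cylinder: "open {\<omega> :: nat \<Rightarrow> bool. \<forall>i<m. \<omega> i = \<omega>0 i}"
proof -
  have "{\<omega> :: nat \<Rightarrow> bool. \<forall>i<m. \<omega> i = \<omega>0 i} = (\<Inter>i<m. (\<lambda>\<omega>. \<omega> i) -` {\<omega>0 i})" by auto
  also have "open \<dots>"
    by (intro open_INT open_vimage continuous_on_product_coordinates open_discrete ballI) auto
  finally show ?thesis .
qed

text \<open>In the product topology on digit sequences, the sequences with given first digits form an open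
  set, so \<open>g\<close> is locally constant.\<close>
lemma continuous_on_finitely_determined:
  fixes g :: "(nat \<Rightarrow> bool) \<Rightarrow> 'b::topological_space"
  assumes "\<And>\<omega> \<omega>'. (\<forall>i<m. \<omega> i = \<omega>' i) \<Longrightarrow> g \<omega> = g \<omega>'"
  shows "continuous_on UNIV g"
  unfolding continuous_on_open_vimage[OF open_UNIV]
proof (intro allI impI)
  fix B :: "'b set"
  show "open (g -` B \<inter> UNIV)"
  proof (subst open_subopen, intro ballI)
    fix \<omega> assume "\<omega> \<in> g -` B \<inter> UNIV"
    then have "g \<omega> \<in> B" by simp
    have "{\<omega>'. \<forall>i<m. \<omega>' i = \<omega> i} \<subseteq> g -` B \<inter> UNIV"
    proof
      fix \<omega>' assume "\<omega>' \<in> {\<omega>'. \<forall>i<m. \<omega>' i = \<omega> i}"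
      then have "g \<omega>' = g \<omega>" by (intro assms) simp
      then show "\<omega>' \<in> g -` B \<inter> UNIV" using \<open>g \<omega> \<in> B\<close> by simp
    qed
    then show "\<exists>T. open T \<and> \<omega> \<in> T \<and> T \<subseteq> g -` B \<inter> UNIV"
      by (intro exI[of _ "{\<omega>'. \<forall>i<m. \<omega>' i = \<omega> i}"] conjI open_cylinder) simp_all
  qed
qed

text \<open>Cylinders over different words of one length keep several digit sequences apart while each of
  them varies in a compact set.\<close>
definition cylinder :: "bool list \<Rightarrow> (nat \<Rightarrow> bool) set" where
  "cylinder u = {\<omega>. map \<omega> [0..<length u] = u}"

lemma closed_cylinder: "closed (cylinder u)"
proof -
  define g :: "(nat \<Rightarrow> bool) \<Rightarrow> bool" where "g \<omega> = (map \<omega> [0..<length u] = u)" for \<omega>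
  have "continuous_on UNIV g"
  proof (rule continuous_on_finitely_determined)
    fix \<omega> \<omega>' :: "nat \<Rightarrow> bool" assume "\<forall>i<length u. \<omega> i = \<omega>' i"
    then have "map \<omega> [0..<length u] = map \<omega>' [0..<length u]" by simp
    then show "g \<omega> = g \<omega>'" unfolding g_def by (simp only:)
  qed
  then have "closed (g -` {True})" by (intro closed_vimage closed_singleton)
  also have "g -` {True} = cylinder u" unfolding g_def cylinder_def vimage_def by simp
  finally show ?thesis .
qed

lemma continuous_on_suminf_finitely_determined:
  fixes g :: "nat \<Rightarrow> (nat \<Rightarrow> bool) \<Rightarrow> real"
  assumes loc: "\<And>i \<omega> \<omega>'. (\<forall>j\<le>i. \<omega> j = \<omega>' j) \<Longrightarrow> g i \<omega> = g i \<omega>'"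
    and bd: "\<And>i \<omega>. \<bar>g i \<omega>\<bar> \<le> M i" and "summable M"
  shows "continuous_on UNIV (\<lambda>\<omega>. \<Sum>i. g i \<omega>)"
proof (rule uniform_limit_theorem)
  show "uniform_limit UNIV (\<lambda>n \<omega>. \<Sum>i<n. g i \<omega>) (\<lambda>\<omega>. \<Sum>i. g i \<omega>) sequentially"
    using bd \<open>summable M\<close> by (intro Weierstrass_m_test) auto
  have "continuous_on UNIV (\<lambda>\<omega>. \<Sum>i<n. g i \<omega>)" for n
  proof (intro continuous_on_sum continuous_on_finitely_determined)
    show "g i \<omega> = g i \<omega>'" if "\<forall>j<Suc i. \<omega> j = \<omega>' j" for i \<omega> \<omega>'
      using that by (intro loc) simp
  qed
  then show "\<forall>\<^sub>F n in sequentially. continuous_on UNIV (\<lambda>\<omega>. \<Sum>i<n. g i \<omega>)"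
    by simp
qed simp

lemma continuous_on_binary:
  assumes a: "strict_mono a"
  shows "continuous_on UNIV (binary a)"
  unfolding binary_def
proof (rule continuous_on_suminf_finitely_determined)
  show "summable (\<lambda>j. 1 / 2 ^ Suc (a j) :: real)"
    using strict_mono_geometric_tail(1)[OF a, of 0] by simp
qed auto

definition words :: "nat \<Rightarrow> bool list set" where
  "words N = {u. length u = N}"

lemma finite_words: "finite (words N)" and card_words: "card (words N) = 2 ^ N"
  using finite_lists_length_eq[of "UNIV :: bool set" N] card_lists_length_eq[of "UNIV :: bool set" N]
  by (simp_all add: words_def)

text \<open>This is what makes prescribing the directions by prefixes possible: finitely many digit
  sequences can be told apart by their prefixes of one common length.\<close>
lemma prefixes_eventually_distinct:
  assumes "finite (F :: (nat \<Rightarrow> bool) set)"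
  shows "\<exists>N. inj_on (\<lambda>\<omega>. map \<omega> [0..<N]) F"
proof -
  define k where "k = (\<lambda>(\<omega>, \<omega>'). LEAST i. \<omega> i \<noteq> (\<omega>' :: nat \<Rightarrow> bool) i)"
  define N where "N = Suc (Max (k ` (F \<times> F)))"
  have "inj_on (\<lambda>\<omega>. map \<omega> [0..<N]) F"
  proof (rule inj_onI, rule ccontr)
    fix \<omega> \<omega>' assume in_F: "\<omega> \<in> F" "\<omega>' \<in> F" and eq: "map \<omega> [0..<N] = map \<omega>' [0..<N]" and "\<omega> \<noteq> \<omega>'"
    then have "\<exists>i. \<omega> i \<noteq> \<omega>' i" by (simp add: fun_eq_iff)
    from LeastI_ex[OF this] have "\<omega> (k (\<omega>, \<omega>')) \<noteq> \<omega>' (k (\<omega>, \<omega>'))" by (simp add: k_def)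
    moreover have "k (\<omega>, \<omega>') < N" unfolding N_def less_Suc_eq_le
      using assms in_F by (intro Max_ge) auto
    ultimately show False using eq by (simp add: list_eq_iff_nth_eq)
  qed
  then show ?thesis by blast
qed

section \<open>Series with blockwise coefficients\<close>

text \<open>Position \<open>i\<close> belongs to block \<open>n\<close> if \<open>fact n \<le> i < fact (Suc n)\<close>, except that block 0 consists of the
  position 0 only.\<close>
definition block :: "nat \<Rightarrow> nat" where
  "block i = (LEAST n. i < fact (Suc n))"

lemma block_le_iff: "block i \<le> n \<longleftrightarrow> i < fact (Suc n)"
proof
  have "i < fact (Suc i)" using fact_ge_self[of "Suc i"] by linarith
  then have "i < fact (Suc (block i))" unfolding block_def by (rule LeastI)
  moreover assume "block i \<le> n"
  ultimately show "i < fact (Suc n)"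
    using fact_mono_nat[of "Suc (block i)" "Suc n"] by linarith
next
  assume "i < fact (Suc n)"
  then show "block i \<le> n" unfolding block_def by (rule Least_le)
qed

lemma block_le: "block i \<le> i"
  unfolding block_le_iff using fact_ge_self[of "Suc i"] by linarith

lemma linear_geometric_tail:
  "(\<lambda>i. (real (i + M) + 1) / 2 ^ Suc (i + M)) sums ((real M + 2) / 2 ^ M)"
proof -
  \<comment> \<open>The tail in closed form, so that the series telescopes.\<close>
  define g where "g i = (real (i + M) + 2) / 2 ^ (i + M)" for i
  have "g \<longlonglongrightarrow> 0" unfolding g_def by real_asymp
  then have "(\<lambda>i. g i - g (Suc i)) sums (g 0 - 0)" by (rule telescope_sums')
  moreover have "g i - g (Suc i) = (real (i + M) + 1) / 2 ^ Suc (i + M)" for i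
    unfolding g_def by (simp add: field_simps)
  ultimately show ?thesis by (simp add: g_def)
qed

definition blockwise :: "(nat \<Rightarrow> (nat \<Rightarrow> bool) \<Rightarrow> real) \<Rightarrow> (nat \<Rightarrow> bool) \<Rightarrow> real" where
  "blockwise \<gamma> \<omega> = (\<Sum>i. of_bool (\<omega> i) * \<gamma> (block i) \<omega> / 2 ^ Suc i)"

lemma blockwise_term_le:
  assumes "\<And>n. \<bar>\<gamma> n \<omega>\<bar> \<le> B * (real n + 1)"
  shows "\<bar>of_bool (\<omega> i) * \<gamma> (block i) \<omega> / 2 ^ Suc i\<bar> \<le> B * ((real i + 1) / 2 ^ Suc i)"
proof -
  have "0 \<le> B" using order_trans[OF abs_ge_zero assms[of 0]] by simp
  have "\<bar>of_bool (\<omega> i) * \<gamma> (block i) \<omega>\<bar> \<le> \<bar>\<gamma> (block i) \<omega>\<bar>" by simp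
  also have "\<dots> \<le> B * (real (block i) + 1)" by (rule assms)
  also have "\<dots> \<le> B * (real i + 1)" using \<open>0 \<le> B\<close> block_le[of i] by (intro mult_left_mono) auto
  finally have "\<bar>of_bool (\<omega> i) * \<gamma> (block i) \<omega>\<bar> / 2 ^ Suc i \<le> B * (real i + 1) / 2 ^ Suc i"
    by (rule divide_right_mono) simp
  then show ?thesis by (simp add: abs_divide)
qed

lemma summable_blockwise_bound: "summable (\<lambda>i. B * ((real i + 1) / 2 ^ Suc i))"
  using sums_summable[OF linear_geometric_tail[of 0]] by (intro summable_mult) simp

lemma summable_blockwise:
  assumes "\<And>n. \<bar>\<gamma> n \<omega>\<bar> \<le> B * (real n + 1)"
  shows "summable (\<lambda>i. of_bool (\<omega> i) * \<gamma> (block i) \<omega> / 2 ^ Suc i)"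
proof (rule summable_comparison_test'[OF summable_blockwise_bound[of B], where N = 0])
  show "norm (of_bool (\<omega> i) * \<gamma> (block i) \<omega> / 2 ^ Suc i) \<le> B * ((real i + 1) / 2 ^ Suc i)" for i
    unfolding real_norm_def using assms by (rule blockwise_term_le)
qed

lemma continuous_on_blockwise:
  assumes loc: "\<And>n \<omega> \<omega>'. (\<forall>i<n. \<omega> i = \<omega>' i) \<Longrightarrow> \<gamma> n \<omega> = \<gamma> n \<omega>'"
    and bd: "\<And>n \<omega>. \<bar>\<gamma> n \<omega>\<bar> \<le> B * (real n + 1)"
  shows "continuous_on UNIV (blockwise \<gamma>)"
  unfolding blockwise_def
proof (rule continuous_on_suminf_finitely_determined[OF _ _ summable_blockwise_bound[of B]])
  show "\<bar>of_bool (\<omega> i) * \<gamma> (block i) \<omega> / 2 ^ Suc i\<bar> \<le> B * ((real i + 1) / 2 ^ Suc i)" for i \<omega>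
    using bd by (rule blockwise_term_le)
next
  fix i :: nat and \<omega> \<omega>' :: "nat \<Rightarrow> bool" assume "\<forall>j\<le>i. \<omega> j = \<omega>' j"
  then have "\<gamma> (block i) \<omega> = \<gamma> (block i) \<omega>'" "\<omega> i = \<omega>' i" using block_le[of i] by (auto intro!: loc)
  then show "of_bool (\<omega> i) * \<gamma> (block i) \<omega> / 2 ^ Suc i = of_bool (\<omega>' i) * \<gamma> (block i) \<omega>' / 2 ^ Suc i"
    by simp
qed

definition head :: "(nat \<Rightarrow> (nat \<Rightarrow> bool) \<Rightarrow> real) \<Rightarrow> nat \<Rightarrow> (nat \<Rightarrow> bool) \<Rightarrow> real" where
  "head \<gamma> m \<omega> = (\<Sum>i<m. of_bool (\<omega> i) * \<gamma> (block i) \<omega> / 2 ^ Suc i)"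

lemma head_cong:
  assumes loc: "\<And>n \<omega> \<omega>'. (\<forall>i<n. \<omega> i = \<omega>' i) \<Longrightarrow> \<gamma> n \<omega> = \<gamma> n \<omega>'"
    and eq: "\<And>i. i < m \<Longrightarrow> \<omega> i = \<omega>' i"
  shows "head \<gamma> m \<omega> = head \<gamma> m \<omega>'"
  unfolding head_def
proof (rule sum.cong[OF refl])
  fix i assume "i \<in> {..<m}"
  then have same: "\<omega> j = \<omega>' j" if "j \<le> i" for j using eq[of j] that by simp
  have "\<gamma> (block i) \<omega> = \<gamma> (block i) \<omega>'" using same block_le[of i] by (intro loc) simp
  then show "of_bool (\<omega> i) * \<gamma> (block i) \<omega> / 2 ^ Suc i = of_bool (\<omega>' i) * \<gamma> (block i) \<omega>' / 2 ^ Suc i"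
    using same[of i] by simp
qed

text \<open>If the coefficient of block \<open>n\<close> vanishes, then the digits before \<open>fact n\<close> determine the value up to
  the size of the digits after \<open>fact (Suc n)\<close>. The factor \<open>fact (Suc n) + 2\<close> stems from the linear growth
  allowed for the coefficients; no fixed bound would do, because the coefficients \<open>t / (t - \<xi> s)\<close> that
  the rational directions require are unbounded.\<close>
lemma blockwise_head_error:
  assumes bd: "\<And>n. \<bar>\<gamma> n \<omega>\<bar> \<le> B * (real n + 1)" and vanishing: "\<gamma> n \<omega> = 0"
  shows "\<bar>blockwise \<gamma> \<omega> - head \<gamma> (fact n) \<omega>\<bar> \<le> B * ((fact (Suc n) + 2) / 2 ^ fact (Suc n))"
proof -
  note term_le = blockwise_term_le[where \<gamma> = \<gamma> and \<omega> = \<omega> and B = B, OF bd]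
  note smbl = summable_blockwise[where \<gamma> = \<gamma> and \<omega> = \<omega> and B = B, OF bd]
  let ?f = "\<lambda>i. of_bool (\<omega> i) * \<gamma> (block i) \<omega> / 2 ^ Suc i"
  define M :: nat where "M = fact (Suc n)"
  have M: "fact n \<le> M" unfolding M_def by (intro fact_mono_nat) simp
  have inside: "?f i = 0" if "fact n \<le> i" "i < M" for i
  proof -
    have "block i = n"
    proof (rule antisym)
      show "block i \<le> n" using that by (simp only: block_le_iff M_def)
      show "n \<le> block i"
      proof (cases n)
        case (Suc k)
        then have "\<not> block i \<le> k" using that block_le_iff[of i k] by (simp del: fact_Suc)
        then show ?thesis using Suc by simp
      qed simp
    qed
    then show ?thesis using vanishing by simp
  qed
  have "head \<gamma> (fact n) \<omega> = sum ?f {..<M}"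
    unfolding head_def using M inside by (intro sum.mono_neutral_left) auto
  then have "blockwise \<gamma> \<omega> - head \<gamma> (fact n) \<omega> = (\<Sum>i. ?f (i + M))"
    unfolding blockwise_def using suminf_split_initial_segment[OF smbl, of M] by simp
  moreover have "\<bar>\<Sum>i. ?f (i + M)\<bar> \<le> (\<Sum>i. B * ((real (i + M) + 1) / 2 ^ Suc (i + M)))"
  proof -
    have "norm (suminf (\<lambda>i. ?f (i + M))) \<le> (\<Sum>i. B * ((real (i + M) + 1) / 2 ^ Suc (i + M)))"
      by (intro norm_suminf_le summable_mult sums_summable[OF linear_geometric_tail])
        (use term_le in \<open>simp only: real_norm_def\<close>)
    then show ?thesis by simp
  qed
  moreover have "(\<Sum>i. B * ((real (i + M) + 1) / 2 ^ Suc (i + M))) = B * ((real M + 2) / 2 ^ M)"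
    by (rule sums_unique[OF sums_mult[OF linear_geometric_tail], symmetric])
  ultimately show ?thesis unfolding M_def by (simp only: of_nat_fact)
qed

section \<open>Rational directions\<close>

text \<open>The coefficients of the direction \<open>(s, t) \<noteq> (0, 0)\<close> are \<open>\<alpha> = t / (t - \<xi> s)\<close> and \<open>\<beta> = - s / (t - \<xi> s)\<close>,
  the unique solution of \<open>\<alpha> + \<xi> \<beta> = 1\<close> and \<open>s \<alpha> + t \<beta> = 0\<close>. The \<open>n\<close>-th step decodes from \<open>n\<close> a table of
  directions for the prefixes of some length, and each table is decoded from infinitely many
  \<open>n\<close>. The default direction \<open>(0, 1)\<close>, that is \<open>\<alpha> = 1\<close> and \<open>\<beta> = 0\<close>, is used as long as the
  prefixes in the table are longer than \<open>n\<close> or the coefficients exceed \<open>n + 1\<close>; for a fixed table this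
  ends eventually.\<close>
lemma directions_exist:
  fixes \<xi> :: real
  assumes "\<xi> \<notin> \<rat>"
  shows "\<exists>\<alpha> \<beta> :: nat \<Rightarrow> (nat \<Rightarrow> bool) \<Rightarrow> real.
     (\<forall>n \<omega>. \<alpha> n \<omega> + \<xi> * \<beta> n \<omega> = 1)
   \<and> (\<forall>n \<omega>. \<bar>\<alpha> n \<omega>\<bar> \<le> real n + 1 \<and> \<bar>\<beta> n \<omega>\<bar> \<le> real n + 1)
   \<and> (\<forall>n \<omega> \<omega>'. (\<forall>i<n. \<omega> i = \<omega>' i) \<longrightarrow> \<alpha> n \<omega> = \<alpha> n \<omega>' \<and> \<beta> n \<omega> = \<beta> n \<omega>')
   \<and> (\<forall>N (s :: bool list \<Rightarrow> rat) (t :: bool list \<Rightarrow> rat) m. \<exists>n\<ge>m. \<forall>\<omega>.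
        of_rat (s (map \<omega> [0..<N])) * \<alpha> n \<omega> + of_rat (t (map \<omega> [0..<N])) * \<beta> n \<omega> = 0)"
proof -
  define den :: "rat \<times> rat \<Rightarrow> real" where "den p = of_rat (snd p) - \<xi> * of_rat (fst p)" for p
  define \<alpha>0 :: "rat \<times> rat \<Rightarrow> real" where "\<alpha>0 p = of_rat (snd p) / den p" for p
  define \<beta>0 :: "rat \<times> rat \<Rightarrow> real" where "\<beta>0 p = - of_rat (fst p) / den p" for p
  have den: "den p \<noteq> 0" if "p \<noteq> (0, 0)" for p
  proof
    assume 0: "den p = 0"
    have "fst p = 0"
    proof (rule ccontr)
      assume "fst p \<noteq> 0"
      then have "\<xi> = of_rat (snd p / fst p)" using 0 by (simp add: den_def of_rat_divide field_simps)
      then show False using assms by simp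
    qed
    then show False using 0 that by (cases p) (simp add: den_def)
  qed
  define good where "good n p \<longleftrightarrow> p \<noteq> (0, 0) \<and> \<bar>\<alpha>0 p\<bar> \<le> real n + 1 \<and> \<bar>\<beta>0 p\<bar> \<le> real n + 1" for n p
  define tab :: "nat \<Rightarrow> nat \<times> (bool list \<times> rat \<times> rat) list" where "tab n = from_nat (fst (prod_decode n))" for n
  define look where "look n \<omega> = (case map_of (snd (tab n)) (map \<omega> [0..<fst (tab n)]) of
        None \<Rightarrow> (0, 1) | Some p \<Rightarrow> p)" for n \<omega>
  define dir where "dir n \<omega> = (if fst (tab n) \<le> n \<and> good n (look n \<omega>) then look n \<omega> else (0, 1))" for n \<omega>
  have good01: "good n (0, 1)" for n by (simp add: good_def \<alpha>0_def \<beta>0_def den_def)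
  have dir: "good n (dir n \<omega>)" for n \<omega> using good01 by (simp add: dir_def)
  define \<alpha> where "\<alpha> n \<omega> = \<alpha>0 (dir n \<omega>)" for n \<omega>
  define \<beta> where "\<beta> n \<omega> = \<beta>0 (dir n \<omega>)" for n \<omega>
  show ?thesis
  proof (rule exI[of _ \<alpha>], rule exI[of _ \<beta>], intro conjI allI)
    fix n :: nat and \<omega> :: "nat \<Rightarrow> bool"
    have "\<alpha>0 p + \<xi> * \<beta>0 p = 1" if "p \<noteq> (0, 0)" for p
      unfolding \<alpha>0_def \<beta>0_def using den[OF that]
      by (simp add: add_divide_distrib[symmetric] diff_divide_distrib[symmetric]) (simp add: den_def)
    then show "\<alpha> n \<omega> + \<xi> * \<beta> n \<omega> = 1" using dir[of n \<omega>] by (simp add: \<alpha>_def \<beta>_def good_def)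
    show "\<bar>\<alpha> n \<omega>\<bar> \<le> real n + 1" "\<bar>\<beta> n \<omega>\<bar> \<le> real n + 1"
      using dir[of n \<omega>] by (simp_all add: \<alpha>_def \<beta>_def good_def)
  next
    fix n :: nat and \<omega> \<omega>' :: "nat \<Rightarrow> bool"
    show "(\<forall>i<n. \<omega> i = \<omega>' i) \<longrightarrow> \<alpha> n \<omega> = \<alpha> n \<omega>' \<and> \<beta> n \<omega> = \<beta> n \<omega>'"
    proof
      assume eq: "\<forall>i<n. \<omega> i = \<omega>' i"
      have "look n \<omega> = look n \<omega>'" if "fst (tab n) \<le> n"
      proof -
        have "map \<omega> [0..<fst (tab n)] = map \<omega>' [0..<fst (tab n)]" using eq that by auto
        then show ?thesis unfolding look_def by (simp only:)
      qed
      then have "dir n \<omega> = dir n \<omega>'" by (auto simp: dir_def)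
      then show "\<alpha> n \<omega> = \<alpha> n \<omega>' \<and> \<beta> n \<omega> = \<beta> n \<omega>'" by (simp add: \<alpha>_def \<beta>_def)
    qed
  next
    fix N m and s t :: "bool list \<Rightarrow> rat"
    define T where "T u = (s u, t u)" for u
    have finL: "finite {u :: bool list. length u = N}"
      using finite_lists_length_eq[of "UNIV :: bool set" N] by simp
    then obtain us where us: "set us = {u :: bool list. length u = N}" using finite_list by blast
    define code where "code = (N, map (\<lambda>u. (u, T u)) us)"
    define B where "B = (\<Sum>u\<in>set us. \<bar>\<alpha>0 (T u)\<bar> + \<bar>\<beta>0 (T u)\<bar>)"
    have B: "\<bar>\<alpha>0 (T u)\<bar> + \<bar>\<beta>0 (T u)\<bar> \<le> B" if "u \<in> set us" for u
      unfolding B_def using that by (intro member_le_sum) auto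
    define k where "k = m + N + nat \<lceil>B\<rceil>"
    \<comment> \<open>The second component of the pair makes \<open>n\<close> as large as required for the same table.\<close>
    define n where "n = prod_encode (to_nat code, k)"
    have n: "k \<le> n" unfolding n_def by (rule le_prod_encode_2)
    have tab: "tab n = code" by (simp add: tab_def n_def)
    have "of_rat (s (map \<omega> [0..<N])) * \<alpha> n \<omega> + of_rat (t (map \<omega> [0..<N])) * \<beta> n \<omega> = 0" for \<omega>
    proof -
      let ?u = "map \<omega> [0..<N]"
      have u: "?u \<in> set us" by (simp add: us)
      have look: "look n \<omega> = T ?u"
        using u by (simp add: look_def tab code_def map_of_map_keys map_of_map_restrict restrict_map_def)
      show ?thesis
      proof (cases "T ?u = (0, 0)")
        case False
        have "B \<le> real n" using n unfolding k_def by linarith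
        then have "good n (T ?u)" using B[OF u] False by (auto simp: good_def)
        then have "dir n \<omega> = T ?u" using n by (simp add: dir_def look tab code_def k_def)
        then show ?thesis by (simp add: \<alpha>_def \<beta>_def \<alpha>0_def \<beta>0_def T_def field_simps)
      qed (simp add: T_def)
    qed
    moreover have "m \<le> n" using n by (simp add: k_def)
    ultimately show "\<exists>n\<ge>m. \<forall>\<omega>. of_rat (s (map \<omega> [0..<N])) * \<alpha> n \<omega>
        + of_rat (t (map \<omega> [0..<N])) * \<beta> n \<omega> = 0" by blast
  qed
qed

section \<open>The rational span of three series\<close>

lemma common_denominator:
  fixes w :: "'i \<Rightarrow> rat"
  assumes "finite I"
  shows "\<exists>(q::int) p. q > 0 \<and> (\<forall>i\<in>I. of_rat (w i) = (real_of_int (p i) / real_of_int q))"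
  using assms
proof (induction I rule: finite_induct)
  case empty
  show ?case by (intro exI[of _ 1]) simp
next
  case (insert i I)
  then obtain q :: int and p where q: "q > 0" and p: "\<forall>i\<in>I. of_rat (w i) = (real_of_int (p i) / real_of_int q)"
    by blast
  obtain x y where xy: "w i = Fract x y" "y > 0" using Rat_cases by blast
  define p' where "p' j = (if j = i then x * q else p j * y)" for j
  have "of_rat (w j) = real_of_int (p' j) / real_of_int (q * y)" if "j \<in> insert i I" for j
    using that q xy p by (auto simp: p'_def of_rat_rat)
  then show ?case using q xy(2) by (intro exI[of _ "q * y"] exI[of _ p']) simp
qed

text \<open>The series \<open>X\<close>, \<open>Y\<close>, \<open>W\<close> of the introduction are \<open>blockwise \<alpha>\<close>, \<open>blockwise \<beta>\<close> and \<open>binary a\<close>.\<close>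
locale three_series =
  fixes \<xi> d :: real and \<alpha> \<beta> :: "nat \<Rightarrow> (nat \<Rightarrow> bool) \<Rightarrow> real" and a :: "nat \<Rightarrow> nat"
  assumes d_nonneg: "0 \<le> d"
    and split: "\<And>n \<omega>. \<alpha> n \<omega> + \<xi> * \<beta> n \<omega> = 1"
    and bound: "\<And>n \<omega>. \<bar>\<alpha> n \<omega>\<bar> \<le> real n + 1" "\<And>n \<omega>. \<bar>\<beta> n \<omega>\<bar> \<le> real n + 1"
    and loc: "\<And>n \<omega> \<omega>'. (\<forall>i<n. \<omega> i = \<omega>' i) \<Longrightarrow> \<alpha> n \<omega> = \<alpha> n \<omega>'"
      "\<And>n \<omega> \<omega>'. (\<forall>i<n. \<omega> i = \<omega>' i) \<Longrightarrow> \<beta> n \<omega> = \<beta> n \<omega>'"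
    and vanishing: "\<And>N (s :: bool list \<Rightarrow> rat) (t :: bool list \<Rightarrow> rat) m. \<exists>n\<ge>m. \<forall>\<omega>.
        of_rat (s (map \<omega> [0..<N])) * \<alpha> n \<omega> + of_rat (t (map \<omega> [0..<N])) * \<beta> n \<omega> = 0"
    and a: "strict_mono a"
    and gap: "\<And>n j. a j < fact (Suc n) \<Longrightarrow> real (a j) \<le> d * fact (Suc n) + fact n"
begin

definition term3 :: "rat \<Rightarrow> rat \<Rightarrow> rat \<Rightarrow> (nat \<Rightarrow> bool) \<Rightarrow> real" where
  "term3 s t w \<omega> = of_rat s * blockwise \<alpha> \<omega> + of_rat t * blockwise \<beta> \<omega> + of_rat w * binary a \<omega>"

text \<open>One digit sequence is chosen in each cylinder of level \<open>N\<close>, so the sequences are distinct, and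
  the coefficients depend on the cylinder only. This keeps the set compact and the coefficients
  fixed while the sequences vary.\<close>
definition comb :: "nat \<Rightarrow> (bool list \<Rightarrow> rat \<times> rat \<times> rat) \<Rightarrow> real set" where
  "comb N c = (\<lambda>f. \<Sum>u\<in>words N. (case c u of (s, t, w) \<Rightarrow> term3 s t w (f u)))
      ` {f. \<forall>u\<in>words N. f u \<in> cylinder u}"

definition A :: "real set" where
  "A = (\<Union>N. \<Union>c. comb N c)"

lemma continuous_on_term3: "continuous_on UNIV (term3 s t w)"
  unfolding term3_def
  using loc bound
  by (intro continuous_intros continuous_on_binary a continuous_on_blockwise[where B = 1]; simp)

lemma compact_comb: "compact (comb N c)"
  unfolding comb_def
proof (rule compact_continuous_image)
  let ?K = "{f :: bool list \<Rightarrow> nat \<Rightarrow> bool. \<forall>u\<in>words N. f u \<in> cylinder u}"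
  have cont: "continuous_on UNIV (\<lambda>f :: bool list \<Rightarrow> nat \<Rightarrow> bool. f u)" for u
    by (rule continuous_on_product_coordinates)
  have "continuous_on UNIV (\<lambda>f. term3 s t w (f u))" for s t w and u :: "bool list"
    by (rule continuous_on_compose2[OF continuous_on_term3 cont]) simp
  then show "continuous_on ?K (\<lambda>f. \<Sum>u\<in>words N. case c u of (s, t, w) \<Rightarrow> term3 s t w (f u))"
    unfolding case_prod_beta by (intro continuous_on_sum) (rule continuous_on_subset, auto)
  have "?K = (\<Inter>u\<in>words N. (\<lambda>f. f u) -` cylinder u)" by auto
  moreover have "closed \<dots>" by (intro closed_INT ballI closed_vimage closed_cylinder cont)
  moreover have "compact (UNIV :: (bool list \<Rightarrow> nat \<Rightarrow> bool) set)"
    by (intro compact_UNIV_fun compact_UNIV_bool)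
  ultimately show "compact ?K" using compact_Int_closed[of UNIV] by simp
qed

lemma blockwise_linear:
  "x * blockwise \<alpha> \<omega> + y * blockwise \<beta> \<omega> = blockwise (\<lambda>n \<omega>. x * \<alpha> n \<omega> + y * \<beta> n \<omega>) \<omega>"
proof -
  have "summable (\<lambda>i. of_bool (\<omega> i) * \<alpha> (block i) \<omega> / 2 ^ Suc i)"
       "summable (\<lambda>i. of_bool (\<omega> i) * \<beta> (block i) \<omega> / 2 ^ Suc i)"
    using bound by (intro summable_blockwise[where B = 1]; simp)+
  then have "(\<lambda>i. x * (of_bool (\<omega> i) * \<alpha> (block i) \<omega> / 2 ^ Suc i)
        + y * (of_bool (\<omega> i) * \<beta> (block i) \<omega> / 2 ^ Suc i)) sums
      (x * blockwise \<alpha> \<omega> + y * blockwise \<beta> \<omega>)"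
    unfolding blockwise_def by (intro sums_add sums_mult summable_sums)
  moreover have "x * (of_bool (\<omega> i) * \<alpha> (block i) \<omega> / 2 ^ Suc i)
        + y * (of_bool (\<omega> i) * \<beta> (block i) \<omega> / 2 ^ Suc i)
      = of_bool (\<omega> i) * (x * \<alpha> (block i) \<omega> + y * \<beta> (block i) \<omega>) / 2 ^ Suc i" for i
    by (simp add: field_simps)
  ultimately show ?thesis unfolding blockwise_def by (simp add: sums_iff)
qed

text \<open>Choose \<open>n\<close> such that the coefficients of block \<open>n\<close> vanish for all the terms at once. Then a point of
  the set is determined, up to the stated radius, by two data: the prefixes of length \<open>fact n\<close> of
  the digit sequences (the set \<open>F1\<close>, with at most \<open>2 ^ fact n\<close> possibilities for each sequence), and a
  point of a grid for the combination of the values of \<open>binary a\<close> (the set \<open>F2\<close>).\<close>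
lemma comb_cover:
  "\<exists>C D l. 0 \<le> C \<and> 0 \<le> D \<and> (\<forall>m. \<exists>n\<ge>m. \<exists>F. finite F
      \<and> card F \<le> C * 2 powr (l * fact n + d * fact (Suc n))
      \<and> comb N c \<subseteq> (\<Union>v\<in>F. cball v (D * ((fact (Suc n) + 2) / 2 ^ fact (Suc n)))))"
proof -
  define s t w where "s u = fst (c u)" and "t u = fst (snd (c u))" and "w u = snd (snd (c u))" for u
  define \<gamma> where "\<gamma> u n \<omega> = of_rat (s u) * \<alpha> n \<omega> + of_rat (t u) * \<beta> n \<omega>" for u n \<omega>
  have \<gamma>_fun: "\<gamma> u = (\<lambda>n \<omega>. of_rat (s u) * \<alpha> n \<omega> + of_rat (t u) * \<beta> n \<omega>)" for u
    by (intro ext) (simp add: \<gamma>_def)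
  define B :: "bool list \<Rightarrow> real" where "B u = \<bar>of_rat (s u)\<bar> + \<bar>of_rat (t u)\<bar>" for u
  have \<gamma>_bound: "\<bar>\<gamma> u n \<omega>\<bar> \<le> B u * (real n + 1)" for u n \<omega>
  proof -
    have "\<bar>\<gamma> u n \<omega>\<bar> \<le> \<bar>of_rat (s u)\<bar> * \<bar>\<alpha> n \<omega>\<bar> + \<bar>of_rat (t u)\<bar> * \<bar>\<beta> n \<omega>\<bar>"
      unfolding \<gamma>_def abs_mult[symmetric] by (rule abs_triangle_ineq)
    also have "\<dots> \<le> \<bar>of_rat (s u)\<bar> * (real n + 1) + \<bar>of_rat (t u)\<bar> * (real n + 1)"
      by (intro add_mono mult_left_mono bound) auto
    finally show ?thesis by (simp add: B_def algebra_simps)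
  qed
  have \<gamma>_loc: "\<gamma> u n \<omega> = \<gamma> u n \<omega>'" if "\<forall>i<n. \<omega> i = \<omega>' i" for u n \<omega> \<omega>'
    using loc[OF that] by (simp add: \<gamma>_def)
  obtain q :: int and p where q: "q > 0"
    and p: "\<And>u. u \<in> words N \<Longrightarrow> of_rat (w u) = (real_of_int (p u) / real_of_int q)"
    using common_denominator[OF finite_words, of N w] by blast
  define H where "H = (\<Sum>u\<in>words N. \<bar>p u\<bar>)"
  have H: "0 \<le> H" unfolding H_def by (intro sum_nonneg) simp
  define D :: real where "D = (\<Sum>u\<in>words N. B u) + (\<Sum>u\<in>words N. \<bar>of_rat (w u)\<bar>)"
  define C :: real where "C = 2 * (2 * real_of_int H + 1)"
  define l :: real where "l = real (card (words N)) + 1"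
  have "0 \<le> C" using H by (simp add: C_def)
  moreover have "0 \<le> D" unfolding D_def B_def by (intro add_nonneg_nonneg sum_nonneg) auto
  moreover have "\<exists>n\<ge>m. \<exists>F. finite F \<and> card F \<le> C * 2 powr (l * fact n + d * fact (Suc n))
      \<and> comb N c \<subseteq> (\<Union>v\<in>F. cball v (D * ((fact (Suc n) + 2) / 2 ^ fact (Suc n))))" for m
  proof -
    obtain n where n: "n \<ge> m" and kill: "\<And>\<omega>. \<gamma> (map \<omega> [0..<N]) n \<omega> = 0"
      using vanishing[of m s N t] unfolding \<gamma>_def by blast
    define M :: nat where "M = fact (Suc n)"
    define K where "K = nat \<lfloor>d * M\<rfloor> + fact n + 1"
    define T where "T = (real M + 2) / 2 ^ M"
    have K: "Suc (a j) \<le> K" if "a j < M" for j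
    proof -
      have "real (a j) \<le> d * M + fact n" using gap that unfolding M_def by (simp only: of_nat_fact)
      then have "real (a j) < real_of_int (\<lfloor>d * M\<rfloor> + 1 + fact n)" by simp linarith
      then have "int (a j) < \<lfloor>d * M\<rfloor> + 1 + fact n" by linarith
      moreover have "int K = \<lfloor>d * M\<rfloor> + fact n + 1" unfolding K_def using d_nonneg by simp
      ultimately show ?thesis by linarith
    qed
    \<comment> \<open>A word is extended by zeros; heads of length \<open>fact n\<close> do not see the extension.\<close>
    define ext where "ext v i = (i < length v \<and> v ! i)" for v :: "bool list" and i :: nat
    define \<Phi> where "\<Phi> g = (\<Sum>u\<in>words N. head (\<gamma> u) (fact n) (ext (g u)))" for g
    define F1 where "F1 = \<Phi> ` (words N \<rightarrow>\<^sub>E words (fact n))"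
    define F2 where "F2 = (\<lambda>h. real_of_int h / (real_of_int q * 2 ^ K)) ` {- H * 2 ^ K .. H * 2 ^ K}"
    define F where "F = (\<lambda>(x, y). x + y) ` (F1 \<times> F2)"
    have fin1: "finite F1" unfolding F1_def by (intro finite_imageI finite_PiE finite_words)
    have fin2: "finite F2" unfolding F2_def by simp
    have "card F1 \<le> card (words N \<rightarrow>\<^sub>E words (fact n))"
      unfolding F1_def by (intro card_image_le finite_PiE finite_words)
    also have "\<dots> = (2 ^ fact n) ^ card (words N)"
      by (simp add: card_PiE finite_words card_words)
    finally have c1: "card F1 \<le> 2 ^ (fact n * card (words N))" by (simp add: power_mult)
    have "card F2 \<le> card {- H * 2 ^ K .. H * 2 ^ K}" unfolding F2_def by (intro card_image_le) simp
    also have "\<dots> = nat (2 * H * 2 ^ K + 1)" by (simp add: algebra_simps)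
    finally have "int (card F2) \<le> 2 * H * 2 ^ K + 1" using H by (simp add: le_nat_iff)
    then have "real_of_int (int (card F2)) \<le> real_of_int (2 * H * 2 ^ K + 1)"
      by (simp only: of_int_le_iff)
    then have "real (card F2) \<le> real_of_int (2 * H * 2 ^ K + 1)" by (simp only: of_int_of_nat_eq)
    also have "\<dots> \<le> (2 * real_of_int H + 1) * 2 ^ K" by (simp add: algebra_simps)
    also have "\<dots> \<le> (2 * real_of_int H + 1) * (2 * 2 powr (d * M + fact n))"
    proof (rule mult_left_mono)
      have "real K \<le> d * M + fact n + 1" unfolding K_def using d_nonneg by simp
      then have "2 powr real K \<le> 2 powr (d * M + fact n + 1)" by (intro powr_mono) auto
      then show "2 ^ K \<le> 2 * 2 powr (d * M + fact n)" by (simp add: powr_realpow powr_add)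
    qed (use H in simp)
    finally have c2: "real (card F2) \<le> C * 2 powr (d * M + fact n)"
      by (simp add: C_def algebra_simps)
    have "card F \<le> card F1 * card F2"
      unfolding F_def using card_image_le[of "F1 \<times> F2" "\<lambda>(x, y). x + y"] fin1 fin2
      by (simp add: card_cartesian_product)
    then have "real (card F) \<le> real (card F1) * real (card F2)" by (simp flip: of_nat_mult)
    also have "\<dots> \<le> 2 ^ (fact n * card (words N)) * (C * 2 powr (d * M + fact n))"
      using c1 c2 by (intro mult_mono) (auto simp: numeral_power_le_of_nat_cancel_iff)
    also have "\<dots> = C * (2 powr (fact n * real (card (words N))) * 2 powr (d * M + fact n))"
      by (simp add: powr_realpow[symmetric])
    also have "\<dots> = C * 2 powr (l * fact n + d * M)"
      unfolding powr_add[symmetric] by (simp add: l_def algebra_simps)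
    finally have "card F \<le> C * 2 powr (l * fact n + d * M)" .
    moreover have "finite F" unfolding F_def using fin1 fin2 by simp
    moreover have "comb N c \<subseteq> (\<Union>v\<in>F. cball v (D * T))"
    proof
      fix x assume "x \<in> comb N c"
      then obtain f where f: "\<And>u. u \<in> words N \<Longrightarrow> f u \<in> cylinder u"
        and "x = (\<Sum>u\<in>words N. case c u of (s, t, w) \<Rightarrow> term3 s t w (f u))"
        unfolding comb_def by blast
      then have x: "x = (\<Sum>u\<in>words N. blockwise (\<gamma> u) (f u) + of_rat (w u) * binary a (f u))"
        by (simp add: \<gamma>_fun s_def t_def w_def term3_def case_prod_beta blockwise_linear)
      have "\<forall>u. \<exists>h :: int. 0 \<le> h \<and> h \<le> 2 ^ K \<and> \<bar>binary a (f u) - of_int h / 2 ^ K\<bar> \<le> 1 / 2 ^ M"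
        using binary_dyadic_approx[OF a K] by blast
      then obtain h :: "bool list \<Rightarrow> int" where h: "\<And>u. 0 \<le> h u" "\<And>u. h u \<le> 2 ^ K"
          "\<And>u. \<bar>binary a (f u) - of_int (h u) / 2 ^ K\<bar> \<le> 1 / 2 ^ M"
        by metis
      define g where "g = (\<lambda>u\<in>words N. map (f u) [0..<fact n])"
      have g: "g \<in> words N \<rightarrow>\<^sub>E words (fact n)" by (auto simp: g_def words_def)
      have head_g: "head (\<gamma> u) (fact n) (f u) = head (\<gamma> u) (fact n) (ext (g u))" if "u \<in> words N" for u
        by (rule head_cong[OF \<gamma>_loc]) (auto simp: g_def ext_def that)
      define y where "y = (\<Sum>u\<in>words N. p u * h u)"
      have "\<bar>y\<bar> \<le> (\<Sum>u\<in>words N. \<bar>p u\<bar> * 2 ^ K)"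
        unfolding y_def using h(1,2)
        by (intro order_trans[OF sum_abs] sum_mono) (auto simp: abs_mult intro!: mult_left_mono)
      also have "\<dots> = H * 2 ^ K" by (simp add: H_def sum_distrib_right)
      finally have y: "y \<in> {- H * 2 ^ K .. H * 2 ^ K}" by (auto simp: abs_le_iff)
      define v where "v = \<Phi> g + real_of_int y / (real_of_int q * 2 ^ K)"
      have "v \<in> F"
        unfolding F_def v_def F1_def F2_def using g y by (intro image_eqI[where x = "(_, _)"]) auto
      have "real_of_int y / (real_of_int q * 2 ^ K) = (\<Sum>u\<in>words N. of_rat (w u) * (of_int (h u) / 2 ^ K))"
        using p by (simp add: y_def sum_divide_distrib)
      then have v: "v = (\<Sum>u\<in>words N. head (\<gamma> u) (fact n) (f u) + of_rat (w u) * (of_int (h u) / 2 ^ K))"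
        using head_g by (simp add: v_def \<Phi>_def sum.distrib)
      have "\<bar>x - v\<bar> \<le> (\<Sum>u\<in>words N. B u * T + \<bar>of_rat (w u)\<bar> * T)"
        unfolding x v sum_subtractf[symmetric]
      proof (intro order_trans[OF sum_abs] sum_mono)
        fix u assume u: "u \<in> words N"
        have "map (f u) [0..<N] = u" using f[OF u] u by (simp add: cylinder_def words_def)
        then have "\<gamma> u n (f u) = 0" using kill[of "f u"] by simp
        then have 1: "\<bar>blockwise (\<gamma> u) (f u) - head (\<gamma> u) (fact n) (f u)\<bar> \<le> B u * T"
          unfolding T_def M_def of_nat_fact by (intro blockwise_head_error \<gamma>_bound)
        have "1 / 2 ^ M \<le> T" unfolding T_def by (intro divide_right_mono) auto
        then have "\<bar>binary a (f u) - of_int (h u) / 2 ^ K\<bar> \<le> T" using h(3)[of u] by linarith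
        then have "\<bar>of_rat (w u)\<bar> * \<bar>binary a (f u) - of_int (h u) / 2 ^ K\<bar> \<le> \<bar>of_rat (w u)\<bar> * T"
          by (intro mult_left_mono) auto
        then have 2: "\<bar>of_rat (w u) * binary a (f u) - of_rat (w u) * (of_int (h u) / 2 ^ K)\<bar> \<le> \<bar>of_rat (w u)\<bar> * T"
          by (simp only: abs_mult[symmetric] right_diff_distrib)
        show "\<bar>blockwise (\<gamma> u) (f u) + of_rat (w u) * binary a (f u)
            - (head (\<gamma> u) (fact n) (f u) + of_rat (w u) * (of_int (h u) / 2 ^ K))\<bar>
          \<le> B u * T + \<bar>of_rat (w u)\<bar> * T"
          using 1 2 by linarith
      qed
      also have "\<dots> = D * T" by (simp add: D_def sum.distrib sum_distrib_right distrib_right)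
      finally have "x \<in> cball v (D * T)" by (simp add: dist_real_def abs_minus_commute)
      then show "x \<in> (\<Union>v\<in>F. cball v (D * T))" using \<open>v \<in> F\<close> by blast
    qed
    ultimately show ?thesis using n unfolding M_def T_def of_nat_fact by blast
  qed
  ultimately show ?thesis by blast
qed

lemma comb_null:
  assumes "d < s" shows "hausdorff_measure s (comb N c) = 0"
proof -
  obtain C D l where "0 \<le> C" "0 \<le> D" and cov: "\<forall>m. \<exists>n\<ge>m. \<exists>F. finite F
      \<and> card F \<le> C * 2 powr (l * fact n + d * fact (Suc n))
      \<and> comb N c \<subseteq> (\<Union>v\<in>F. cball v (D * ((fact (Suc n) + 2) / 2 ^ fact (Suc n))))"
    using comb_cover[of N c] by blast
  show ?thesis
    by (rule null_if_block_covers[OF d_nonneg assms \<open>0 \<le> C\<close> \<open>0 \<le> D\<close> cov[rule_format]])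
qed

text \<open>Once the given digit sequences have distinct prefixes of length \<open>N\<close>, the coefficients can be
  attached to these prefixes; cylinders that contain none of the sequences get the coefficients 0
  and an arbitrary sequence. Together with the converse below, this identifies \<open>A\<close> with the
  rational span of the values of the three series.\<close>
lemma finite_combination_in_A:
  assumes F: "finite F"
  shows "(\<Sum>\<omega>\<in>F. term3 (s \<omega>) (t \<omega>) (w \<omega>) \<omega>) \<in> A"
proof -
  obtain N where inj: "inj_on (\<lambda>\<omega>. map \<omega> [0..<N]) F" using prefixes_eventually_distinct[OF F] by blast
  define \<pi> where "\<pi> \<omega> = map \<omega> [0..<N]" for \<omega> :: "nat \<Rightarrow> bool"
  have inj: "inj_on \<pi> F" using inj by (simp add: \<pi>_def[abs_def])
  define r where "r = the_inv_into F \<pi>"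
  have r: "r (\<pi> \<omega>) = \<omega>" if "\<omega> \<in> F" for \<omega> unfolding r_def using inj that by (rule the_inv_into_f_f)
  define f where "f u = (if u \<in> \<pi> ` F then r u else (\<lambda>i. i < length u \<and> u ! i))" for u
  define c where "c u = (if u \<in> \<pi> ` F then (s (r u), t (r u), w (r u)) else (0, 0, 0))" for u
  have "f u \<in> cylinder u" if "u \<in> words N" for u
  proof (cases "u \<in> \<pi> ` F")
    case True
    then obtain \<omega> where "\<omega> \<in> F" "u = \<pi> \<omega>" by blast
    then show ?thesis using r that by (simp add: f_def cylinder_def \<pi>_def words_def)
  next
    case False
    then show ?thesis by (auto simp: f_def cylinder_def intro!: nth_equalityI)
  qed
  moreover have "(\<Sum>\<omega>\<in>F. term3 (s \<omega>) (t \<omega>) (w \<omega>) \<omega>) = (\<Sum>u\<in>words N. case c u of (s, t, w) \<Rightarrow> term3 s t w (f u))"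
  proof -
    have "(\<Sum>u\<in>words N. case c u of (s, t, w) \<Rightarrow> term3 s t w (f u))
        = (\<Sum>u\<in>\<pi> ` F. case c u of (s, t, w) \<Rightarrow> term3 s t w (f u))"
      by (intro sum.mono_neutral_right finite_words) (auto simp: \<pi>_def words_def c_def term3_def)
    also have "\<dots> = (\<Sum>\<omega>\<in>F. term3 (s \<omega>) (t \<omega>) (w \<omega>) \<omega>)"
      unfolding sum.reindex[OF inj] by (intro sum.cong refl) (simp add: c_def f_def r)
    finally show ?thesis by simp
  qed
  ultimately have "(\<Sum>\<omega>\<in>F. term3 (s \<omega>) (t \<omega>) (w \<omega>) \<omega>) \<in> comb N c" unfolding comb_def by (intro image_eqI[of _ _ f]) simp_all
  then show ?thesis unfolding A_def by blast
qed

text \<open>The coefficients vanish outside \<open>F\<close>, so that two combinations can be added over the union of their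
  index sets.\<close>
lemma A_finite_combinationE:
  assumes "x \<in> A"
  obtains F s t w where "finite F" "\<forall>\<omega>. \<omega> \<notin> F \<longrightarrow> s \<omega> = 0 \<and> t \<omega> = 0 \<and> w \<omega> = 0"
    "x = (\<Sum>\<omega>\<in>F. term3 (s \<omega>) (t \<omega>) (w \<omega>) \<omega>)"
proof -
  from assms obtain N c f where f: "\<And>u. u \<in> words N \<Longrightarrow> f u \<in> cylinder u"
    and x: "x = (\<Sum>u\<in>words N. case c u of (s, t, w) \<Rightarrow> term3 s t w (f u))"
    unfolding A_def comb_def by blast
  have pre: "map (f u) [0..<N] = u" if "u \<in> words N" for u
    using f[OF that] that by (simp add: cylinder_def words_def)
  have inj: "inj_on f (words N)" using pre by (metis inj_onI)
  define F where "F = f ` words N"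
  define s t w where "s \<omega> = (if \<omega> \<in> F then fst (c (map \<omega> [0..<N])) else 0)"
    and "t \<omega> = (if \<omega> \<in> F then fst (snd (c (map \<omega> [0..<N]))) else 0)"
    and "w \<omega> = (if \<omega> \<in> F then snd (snd (c (map \<omega> [0..<N]))) else 0)" for \<omega>
  have "x = (\<Sum>u\<in>words N. term3 (s (f u)) (t (f u)) (w (f u)) (f u))"
    unfolding x by (intro sum.cong refl) (simp add: s_def t_def w_def F_def pre case_prod_beta)
  also have "\<dots> = (\<Sum>\<omega>\<in>F. term3 (s \<omega>) (t \<omega>) (w \<omega>) \<omega>)"
    unfolding F_def by (simp add: sum.reindex[OF inj])
  finally have eq: "x = (\<Sum>\<omega>\<in>F. term3 (s \<omega>) (t \<omega>) (w \<omega>) \<omega>)" .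
  show thesis
  proof (rule that[OF _ _ eq])
    show "finite F" by (simp add: F_def finite_words)
    show "\<forall>\<omega>. \<omega> \<notin> F \<longrightarrow> s \<omega> = 0 \<and> t \<omega> = 0 \<and> w \<omega> = 0"
      by (simp add: s_def t_def w_def)
  qed
qed

lemma term3_in_A: "term3 s t w \<omega> \<in> A"
  using finite_combination_in_A[of "{\<omega>}" "\<lambda>_. s" "\<lambda>_. t" "\<lambda>_. w"] by simp

lemma term3_add:
  "term3 (s + s') (t + t') (w + w') \<omega> = term3 s t w \<omega> + term3 s' t' w' \<omega>"
  by (simp add: term3_def of_rat_add algebra_simps)

lemma term3_mult: "of_rat q * term3 s t w \<omega> = term3 (q * s) (q * t) (q * w) \<omega>"
  by (simp add: term3_def of_rat_mult algebra_simps)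

lemma subspace_A: "module.subspace rat_scale A"
proof -
  interpret Q: vector_space rat_scale by (rule vector_space_rat_scale)
  show ?thesis
    unfolding Q.subspace_def
  proof (intro conjI ballI allI)
    show "0 \<in> A" using term3_in_A[of 0 0 0 "\<lambda>_. False"] by (simp add: term3_def)
  next
    fix x y assume "x \<in> A" "y \<in> A"
    from \<open>x \<in> A\<close> obtain F s t w
      where F: "finite F" "\<forall>\<omega>. \<omega> \<notin> F \<longrightarrow> s \<omega> = 0 \<and> t \<omega> = 0 \<and> w \<omega> = 0"
        "x = (\<Sum>\<omega>\<in>F. term3 (s \<omega>) (t \<omega>) (w \<omega>) \<omega>)"
      by (rule A_finite_combinationE) (rule that; assumption)
    from \<open>y \<in> A\<close> obtain F' s' t' w'
      where F': "finite F'" "\<forall>\<omega>. \<omega> \<notin> F' \<longrightarrow> s' \<omega> = 0 \<and> t' \<omega> = 0 \<and> w' \<omega> = 0"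
        "y = (\<Sum>\<omega>\<in>F'. term3 (s' \<omega>) (t' \<omega>) (w' \<omega>) \<omega>)"
      by (rule A_finite_combinationE) (rule that; assumption)
    have "x = (\<Sum>\<omega>\<in>F \<union> F'. term3 (s \<omega>) (t \<omega>) (w \<omega>) \<omega>)"
      unfolding F(3) using F(1) F'(1) by (intro sum.mono_neutral_left) (simp_all add: term3_def F(2))
    moreover have "y = (\<Sum>\<omega>\<in>F \<union> F'. term3 (s' \<omega>) (t' \<omega>) (w' \<omega>) \<omega>)"
      unfolding F'(3) using F(1) F'(1) by (intro sum.mono_neutral_left) (simp_all add: term3_def F'(2))
    ultimately have "x + y = (\<Sum>\<omega>\<in>F \<union> F'. term3 (s \<omega> + s' \<omega>) (t \<omega> + t' \<omega>) (w \<omega> + w' \<omega>) \<omega>)"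
      by (simp only: term3_add sum.distrib)
    also have "\<dots> \<in> A" using F(1) F'(1) by (intro finite_combination_in_A) simp
    finally show "x + y \<in> A" .
  next
    fix q :: rat and x assume "x \<in> A"
    then obtain F s t w
      where F: "finite F" "\<forall>\<omega>. \<omega> \<notin> F \<longrightarrow> s \<omega> = 0 \<and> t \<omega> = 0 \<and> w \<omega> = 0"
        "x = (\<Sum>\<omega>\<in>F. term3 (s \<omega>) (t \<omega>) (w \<omega>) \<omega>)"
      by (rule A_finite_combinationE) (rule that; assumption)
    have "of_rat q * x = (\<Sum>\<omega>\<in>F. term3 (q * s \<omega>) (q * t \<omega>) (q * w \<omega>) \<omega>)"
      unfolding F(3) by (simp only: sum_distrib_left term3_mult)
    also have "\<dots> \<in> A" using F(1) by (rule finite_combination_in_A)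
    finally show "of_rat q * x \<in> A" .
  qed
qed

text \<open>Only the coefficients on the finitely many words of length \<open>N\<close> matter.\<close>
lemma countable_combs: "countable (\<Union>N. range (comb N))"
proof (intro countable_UN)
  fix N
  have "range (comb N) \<subseteq> comb N ` (words N \<rightarrow>\<^sub>E UNIV)"
  proof
    fix S assume "S \<in> range (comb N)"
    then obtain c where S: "S = comb N c" by blast
    have "comb N c = comb N (\<lambda>u\<in>words N. c u)"
      unfolding comb_def by (intro image_cong sum.cong refl) simp
    moreover have "(\<lambda>u\<in>words N. c u) \<in> words N \<rightarrow>\<^sub>E UNIV" by simp
    ultimately show "S \<in> comb N ` (words N \<rightarrow>\<^sub>E UNIV)" unfolding S by (rule image_eqI)
  qed
  then show "countable (range (comb N))"
    by (rule countable_subset) (intro countable_image countable_PiE finite_words countableI_type)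
qed simp

lemma A_eq_Union_combs: "A = \<Union>(\<Union>N. range (comb N))"
  unfolding A_def by blast

lemma fsigma_A: "fsigma_in euclidean A"
  unfolding A_eq_Union_combs
proof (rule fsigma_in_Union[OF countable_combs])
  fix S assume "S \<in> (\<Union>N. range (comb N))"
  then have "closed S" using compact_comb compact_imp_closed by blast
  then show "fsigma_in euclidean S" by (intro closed_imp_fsigma_in) simp
qed

lemma hausdorff_measure_A_null:
  assumes "d < s" shows "hausdorff_measure s A = 0"
  unfolding A_eq_Union_combs
proof (rule hausdorff_measure_null_Union[OF countable_combs])
  fix S assume "S \<in> (\<Union>N. range (comb N))"
  then obtain N c where "S = comb N c" by blast
  then show "hausdorff_measure s S = 0" using comb_null[OF assms] by simp
qed

text \<open>Every real is a rational multiple of a number in \<open>[0, 1)\<close>, and the latter equals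
  \<open>X \<omega> + \<xi> * Y \<omega>\<close> for its binary digits \<open>\<omega>\<close>.\<close>
lemma A_plus_xi_A: "{x + \<xi> * y | x y. x \<in> A \<and> y \<in> A} = UNIV"
proof (intro set_eqI iffI UNIV_I)
  fix v :: real
  define q :: rat where "q = (if 0 \<le> v then of_int (\<lfloor>v\<rfloor> + 1) else of_int (\<lfloor>v\<rfloor> - 1))"
  have "of_rat q \<noteq> (0 :: real) \<and> 0 \<le> v / of_rat q \<and> v / of_rat q < 1"
  proof (cases "0 \<le> v")
    case True
    define k where "k = real_of_int \<lfloor>v\<rfloor>"
    have "of_rat q = k + 1" using True by (simp add: q_def k_def of_rat_add)
    moreover have "v < k + 1" "0 \<le> k" using True by (simp_all add: k_def)
    ultimately show ?thesis using True by (simp add: divide_less_eq)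
  next
    case False
    then have "of_rat q = of_int \<lfloor>v\<rfloor> - (1 :: real)" by (simp add: q_def of_rat_diff)
    moreover have "of_int \<lfloor>v\<rfloor> - 1 < v" by linarith
    ultimately show ?thesis using False
      by (simp add: divide_less_eq zero_le_divide_iff)
  qed
  then obtain \<omega> where q: "of_rat q \<noteq> (0 :: real)" and \<omega>: "binary id \<omega> = v / of_rat q"
    using range_binary_id by (metis atLeastLessThan_iff imageE subsetD)
  have "blockwise \<alpha> \<omega> + \<xi> * blockwise \<beta> \<omega> = binary id \<omega>"
    using blockwise_linear[of 1 \<omega> \<xi>] by (simp add: split) (simp add: blockwise_def binary_def)
  then have "v = of_rat q * (blockwise \<alpha> \<omega> + \<xi> * blockwise \<beta> \<omega>)" using q \<omega> by simp
  then have "v = term3 q 0 0 \<omega> + \<xi> * term3 0 q 0 \<omega>" by (simp add: term3_def algebra_simps)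
  then show "v \<in> {x + \<xi> * y | x y. x \<in> A \<and> y \<in> A}" using term3_in_A by blast
qed

lemma hausdorff_measure_A_pos:
  assumes slow: "\<And>j. real (a j) \<le> real j / d + c" and "0 < d" "0 \<le> s" "s \<le> d"
  shows "hausdorff_measure s A \<noteq> 0"
proof -
  have "range (binary a) \<subseteq> A"
  proof
    fix x assume "x \<in> range (binary a)"
    then obtain \<omega> where "x = term3 0 0 1 \<omega>" by (auto simp: term3_def)
    then show "x \<in> A" using term3_in_A by simp
  qed
  moreover have "hausdorff_measure s (range (binary a)) \<noteq> 0"
    using binary_Holder[OF a \<open>0 < d\<close> slow] range_binary_id assms(3,4)
    by (intro hausdorff_measure_pos_if_Holder_onto[where z = "binary id" and d = d]) auto
  ultimately show ?thesis using hausdorff_measure_mono[of "range (binary a)" A s] by auto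
qed

end

section \<open>Construction of the subspace\<close>

theorem theorem1p1:
  fixes \<xi> d :: real
  assumes "\<xi> \<notin> \<rat>" and "0 \<le> d" and "d < 1"
  shows "\<exists>A :: real set.
           fsigma_in euclidean A
         \<and> module.subspace rat_scale A
         \<and> hausdorff_dim A = ereal d
         \<and> {a + \<xi> * b | a b. a \<in> A \<and> b \<in> A} = UNIV"
proof -
  obtain a :: "nat \<Rightarrow> nat" where pos: "strict_mono a"
      "\<forall>n j. a j < fact (Suc n) \<longrightarrow> real (a j) \<le> d * fact (Suc n) + fact n"
      "0 < d \<longrightarrow> (\<exists>c. \<forall>j. real (a j) \<le> real j / d + c)"
    using gapped_positions_exist[OF assms(2,3)] by (elim exE conjE) (rule that; assumption)
  obtain \<alpha> \<beta> :: "nat \<Rightarrow> (nat \<Rightarrow> bool) \<Rightarrow> real" where dir: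
      "\<forall>n \<omega>. \<alpha> n \<omega> + \<xi> * \<beta> n \<omega> = 1"
      "\<forall>n \<omega>. \<bar>\<alpha> n \<omega>\<bar> \<le> real n + 1 \<and> \<bar>\<beta> n \<omega>\<bar> \<le> real n + 1"
      "\<forall>n \<omega> \<omega>'. (\<forall>i<n. \<omega> i = \<omega>' i) \<longrightarrow> \<alpha> n \<omega> = \<alpha> n \<omega>' \<and> \<beta> n \<omega> = \<beta> n \<omega>'"
      "\<forall>N (s :: bool list \<Rightarrow> rat) (t :: bool list \<Rightarrow> rat) m. \<exists>n\<ge>m. \<forall>\<omega>.
        of_rat (s (map \<omega> [0..<N])) * \<alpha> n \<omega> + of_rat (t (map \<omega> [0..<N])) * \<beta> n \<omega> = 0"
    using directions_exist[OF assms(1)] by (elim exE conjE) (rule that; assumption)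
  interpret three_series \<xi> d \<alpha> \<beta> a
  proof
    show "0 \<le> d" by (rule assms(2))
    show "\<alpha> n \<omega> + \<xi> * \<beta> n \<omega> = 1" for n \<omega> by (rule dir(1)[rule_format])
    show "\<bar>\<alpha> n \<omega>\<bar> \<le> real n + 1" "\<bar>\<beta> n \<omega>\<bar> \<le> real n + 1" for n \<omega>
      using dir(2)[rule_format, of n \<omega>] by simp_all
    show "\<alpha> n \<omega> = \<alpha> n \<omega>'" "\<beta> n \<omega> = \<beta> n \<omega>'" if "\<forall>i<n. \<omega> i = \<omega>' i" for n \<omega> \<omega>'
      using dir(3)[rule_format, of n \<omega> \<omega>'] that by auto
    show "\<exists>n\<ge>m. \<forall>\<omega>. of_rat (s (map \<omega> [0..<N])) * \<alpha> n \<omega> + of_rat (t (map \<omega> [0..<N])) * \<beta> n \<omega> = 0"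
      for N m and s t :: "bool list \<Rightarrow> rat"
      by (rule dir(4)[rule_format])
    show "strict_mono a" by (rule pos(1))
    show "real (a j) \<le> d * fact (Suc n) + fact n" if "a j < fact (Suc n)" for n j
      using pos(2)[rule_format, OF that] .
  qed
  have "hausdorff_dim A = ereal d"
  proof (rule hausdorff_dim_eqI[OF assms(2) hausdorff_measure_A_null])
    fix s assume "0 \<le> s" "s < d"
    moreover from this obtain c where "\<And>j. real (a j) \<le> real j / d + c" using pos(3) by auto
    ultimately show "hausdorff_measure s A \<noteq> 0" by (intro hausdorff_measure_A_pos) auto
  qed
  then show ?thesis using fsigma_A subspace_A A_plus_xi_A by (intro exI[of _ A]) simp
qed

end
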